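(* Let $\mathcal{C}: f_{\mathcal{C}}=0$ be a reduced curve in the complex projective plane that is not free. Then $\mathcal{C}$ is plus-one generated (POG) if and only if there exists a set of homogeneous derivations $\{\theta_1,\theta_2,\theta_3\}\subset D(\mathcal{C})$ such that $0\neq g_{123}\in S_1$, where $g_{123}\in S$ is the polynomial determined by $\det M(\theta_1,\theta_2,\theta_3)=g_{123}\, f_{\mathcal{C}}$.
   Context: $S=\mathbb{C}[x,y,z]$ with its standard grading, and $S_1$ is its degree-one homogeneous component. $\mathrm{Der}(S)=S\partial_x\oplus S\partial_y\oplus S\partial_z$ is the module of derivations of $S$; a derivation $a\partial_x+b\partial_y+c\partial_z$ is homogeneous of degree $e$ if $a,b,c$ are homogeneous polynomials of the same degree $e$. For a reduced plane curve $\mathcal{C}: f_{\mathcal{C}}=0$ ($f_{\mathcal{C}}\in S$ homogeneous and reduced), $D(\mathcal{C})=\{\theta\in \mathrm{Der}(S) : \theta(f_{\mathcal{C}})\in f_{\mathcal{C}}S\}$, a graded $S$-module. The curve $\mathcal{C}$ is free if $D(\mathcal{C})$ is a free $S$-module. It is plus-one generated (POG) if $D(\mathcal{C})$ admits a minimal system of homogeneous generators $\{\theta_1,\theta_2,\theta_3,\theta_4\}$ satisfying a unique relation $f_1\theta_1+f_2\theta_2+f_3\theta_3+f_4\theta_4=0$ (that is, the module of relations among these generators is generated by this single one), with $f_i\in S$ homogeneous and $\deg f_4=1$. For homogeneous derivations $\theta_1,\theta_2,\theta_3\in D(\mathcal{C})$, $M(\theta_1,\theta_2,\theta_3)$ is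 the $3\times 3$ matrix whose $i$-th row consists of the coefficients of $\theta_i$ with respect to $\partial_x,\partial_y,\partial_z$; its determinant is always divisible by $f_{\mathcal{C}}$, so $g_{123}$ is well defined. *)

theory Defs
  imports
    "HOL-Analysis.Analysis"
    "HOL-Computational_Algebra.Computational_Algebra"
begin

text \<open>
  The ring \<open>S = \<complex>[x,y,z]\<close> is rendered as \<open>\<complex>[x][y][z]\<close>: the outermost variable is \<open>z\<close>, the
  innermost is \<open>x\<close>.
\<close>

type_synonym S = "complex poly poly poly"

definition var_x :: S where "var_x = [:[:[:0, 1:]:]:]"
definition var_y :: S where "var_y = [:[:0, 1:]:]"
definition var_z :: S where "var_z = [:0, 1:]"
definition const :: "complex \<Rightarrow> S" where "const c = [:[:[:c:]:]:]"

text \<open>Coefficient of \<open>x\<^sup>i y\<^sup>j z\<^sup>k\<close>.\<close>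

definition mcoeff :: "S \<Rightarrow> nat \<Rightarrow> nat \<Rightarrow> nat \<Rightarrow> complex" where
  "mcoeff p i j k = coeff (coeff (coeff p k) j) i"

text \<open>The zero polynomial is homogeneous of every degree.\<close>

definition homogeneous :: "nat \<Rightarrow> S \<Rightarrow> bool" where
  "homogeneous d p \<longleftrightarrow> (\<forall>i j k. mcoeff p i j k \<noteq> 0 \<longrightarrow> i + j + k = d)"

definition graded_part :: "nat \<Rightarrow> S set" where
  "graded_part d = {p. homogeneous d p}"

definition d_x :: "S \<Rightarrow> S" where "d_x = map_poly (map_poly pderiv)"
definition d_y :: "S \<Rightarrow> S" where "d_y = map_poly pderiv"
definition d_z :: "S \<Rightarrow> S" where "d_z = pderiv"

text \<open>
  \<open>Der(S) = S\<partial>\<^sub>x \<oplus> S\<partial>\<^sub>y \<oplus> S\<partial>\<^sub>z\<close>: the vector \<open>\<theta>\<close> with entries \<open>a, b, c\<close> stands for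
  \<open>a\<partial>\<^sub>x + b\<partial>\<^sub>y + c\<partial>\<^sub>z\<close>, and \<^term>\<open>der_apply \<theta>\<close> is its action on \<open>S\<close>.
\<close>

type_synonym Der = "S ^ 3"

definition der_apply :: "Der \<Rightarrow> S \<Rightarrow> S" where
  "der_apply \<theta> p = \<theta> $ 1 * d_x p + \<theta> $ 2 * d_y p + \<theta> $ 3 * d_z p"

definition homogeneous_der :: "nat \<Rightarrow> Der \<Rightarrow> bool" where
  "homogeneous_der e \<theta> \<longleftrightarrow> (\<forall>i. homogeneous e (\<theta> $ i))"

interpretation der: module "(*s) :: S \<Rightarrow> Der \<Rightarrow> Der"
  by unfold_locales (simp_all add: vec_eq_iff algebra_simps)

definition reduced_curve :: "S \<Rightarrow> bool" where
  "reduced_curve f \<longleftrightarrow> f \<noteq> 0 \<and> (\<exists>d\<ge>1. homogeneous d f) \<and> squarefree f"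

definition D :: "S \<Rightarrow> Der set" where
  "D f = {\<theta>. f dvd der_apply \<theta> f}"

definition free_curve :: "S \<Rightarrow> bool" where
  "free_curve f \<longleftrightarrow> (\<exists>B. der.independent B \<and> der.span B = D f)"

definition minimal_generators :: "Der set \<Rightarrow> S \<Rightarrow> bool" where
  "minimal_generators T f \<longleftrightarrow> der.span T = D f \<and> (\<forall>T'. T' \<subset> T \<longrightarrow> der.span T' \<noteq> D f)"

text \<open>
  The degree of \<open>f\<^sub>4\<close> being 1 includes \<open>f\<^sub>4 \<noteq> 0\<close>; the other \<open>f\<^sub>i\<close> may vanish.
\<close>

definition plus_one_generated :: "S \<Rightarrow> bool" where
  "plus_one_generated f \<longleftrightarrow>
    (\<exists>\<theta>1 \<theta>2 \<theta>3 \<theta>4 f1 f2 f3 f4.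
       distinct [\<theta>1, \<theta>2, \<theta>3, \<theta>4] \<and>
       (\<forall>\<theta>\<in>{\<theta>1, \<theta>2, \<theta>3, \<theta>4}. \<exists>e. homogeneous_der e \<theta>) \<and>
       minimal_generators {\<theta>1, \<theta>2, \<theta>3, \<theta>4} f \<and>
       (\<forall>p\<in>{f1, f2, f3, f4}. \<exists>e. homogeneous e p) \<and>
       f4 \<noteq> 0 \<and> homogeneous 1 f4 \<and>
       (\<forall>a1 a2 a3 a4.
          a1 *s \<theta>1 + a2 *s \<theta>2 + a3 *s \<theta>3 + a4 *s \<theta>4 = 0 \<longleftrightarrow>
          (\<exists>h. a1 = h * f1 \<and> a2 = h * f2 \<and> a3 = h * f3 \<and> a4 = h * f4)))"

text \<open>\<^term>\<open>vector\<close> lists rows, so the \<open>i\<close>-th row consists of the coefficients of \<open>\<theta>\<^sub>i\<close>.\<close>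

definition coeff_matrix :: "Der \<Rightarrow> Der \<Rightarrow> Der \<Rightarrow> S ^ 3 ^ 3" where
  "coeff_matrix \<theta>1 \<theta>2 \<theta>3 = vector [\<theta>1, \<theta>2, \<theta>3]"

text \<open>Checks that the encoding of \<open>S\<close> and of its partial derivatives is the intended one.\<close>

lemma S_monomial_expansion:
  fixes p :: S
  shows "p = (\<Sum>k\<le>degree p. \<Sum>j\<le>degree (coeff p k). \<Sum>i\<le>degree (coeff (coeff p k) j).
               const (mcoeff p i j k) * var_x ^ i * var_y ^ j * var_z ^ k)"
proof -
  have uni: "q = (\<Sum>i\<le>degree q. [:coeff q i:] * [:0, 1:] ^ i)" for q :: "'r::comm_ring_1 poly"
    using poly_as_sum_of_monoms[of q] by (simp add: monom_altdef)
  have cpow: "[:b:] ^ i = [:b ^ i:]" for b :: "'r::comm_ring_1" and i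
    by (induction i) (simp_all add: mult_ac)
  have cadd: "[:a + b:] = [:a:] + [:b:]" for a b :: "'r::comm_ring_1"
    by simp
  have csum: "[:sum g A:] = (\<Sum>i\<in>A. [:g i:])" for g :: "nat \<Rightarrow> 'r::comm_ring_1" and A
    by (induction A rule: infinite_finite_induct) (simp_all add: cadd del: add_pCons)
  have cmul: "[:a * b:] = [:a:] * [:b:]" for a b :: "'r::comm_ring_1"
    by simp
  have "p = (\<Sum>k\<le>degree p. [:coeff p k:] * var_z ^ k)"
    unfolding var_z_def by (rule uni)
  also have "\<dots> = (\<Sum>k\<le>degree p. (\<Sum>j\<le>degree (coeff p k). 
      [:[:coeff (coeff p k) j:]:] * var_y ^ j) * var_z ^ k)"
    by (subst (2) uni) (simp only: csum cmul var_y_def cpow)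
  also have "\<dots> = (\<Sum>k\<le>degree p. (\<Sum>j\<le>degree (coeff p k). 
      (\<Sum>i\<le>degree (coeff (coeff p k) j). const (mcoeff p i j k) * var_x ^ i) * var_y ^ j) * var_z ^ k)"
    by (subst (3) uni) (simp only: csum cmul var_x_def cpow const_def mcoeff_def)
  finally show ?thesis by (simp add: sum_distrib_right)
qed

lemma mcoeff_d:
  "mcoeff (d_x p) i j k = of_nat (Suc i) * mcoeff p (Suc i) j k"
  "mcoeff (d_y p) i j k = of_nat (Suc j) * mcoeff p i (Suc j) k"
  "mcoeff (d_z p) i j k = of_nat (Suc k) * mcoeff p i j (Suc k)"
proof -
  have of_nat_coeff: "coeff (of_nat n * q) i = of_nat n * coeff q i" for n i and q :: "'r::comm_ring_1 poly"
    by (simp add: of_nat_poly)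
  show
    "mcoeff (d_x p) i j k = of_nat (Suc i) * mcoeff p (Suc i) j k"
    "mcoeff (d_y p) i j k = of_nat (Suc j) * mcoeff p i (Suc j) k"
    "mcoeff (d_z p) i j k = of_nat (Suc k) * mcoeff p i j (Suc k)"
    unfolding mcoeff_def d_x_def d_y_def d_z_def
    by (simp_all only: coeff_map_poly map_poly_0 pderiv_0 coeff_pderiv of_nat_coeff)
qed

end

theory Submission
  imports Defs "HOL-Computational_Algebra.Field_as_Ring"
begin

text \<open>
  Since \<open>f\<close> is reduced, Euler's identity shows that its partial derivatives have no common factor.
  Hence \<open>f\<close> divides the determinant of any three elements of \<open>D(f)\<close>, and, using the Euler and
  Koszul derivations, every common divisor of all these determinants divides \<open>f\<close>.

  If \<open>D(f)\<close> has four generators with the single relation \<open>(f\<^sub>1, \<dots>, f\<^sub>4)\<close>, their signed \<open>3 \<times> 3\<close>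
  minors form a relation too, hence equal \<open>h (f\<^sub>1, \<dots>, f\<^sub>4)\<close>. By the above, \<open>h\<close> divides \<open>f\<close>, and the
  quotient divides all \<open>f\<^sub>i\<close>, so it is a unit because \<open>(f\<^sub>1, \<dots>, f\<^sub>4)\<close> generates the relations.
  Thus \<open>f\<^sub>4 f\<close> is, up to a constant, the determinant of the first three generators.

  Conversely, let \<open>det M(\<theta>\<^sub>1, \<theta>\<^sub>2, \<theta>\<^sub>3) = g f\<close> with \<open>g\<close> linear, and let \<open>N\<close> be the span of the \<open>\<theta>\<^sub>i\<close>.
  By Cramer's rule \<open>g \<eta> = \<Sum> a\<^sub>i \<theta>\<^sub>i\<close> for every \<open>\<eta> \<in> D(f)\<close>, and \<open>\<eta> \<mapsto> a mod g\<close> embeds \<open>D(f)/N\<close> into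
  \<open>(S/g)\<^sup>3\<close> as a saturated submodule of rank at most one. As \<open>S/g\<close> is factorial, this submodule is
  generated by a primitive vector, whose preimage, made homogeneous, is the fourth generator.
\<close>

(* Besides vec_nth, fps_nth is written with the same infix $; the ambiguity makes long terms unparsable. *)
no_notation fps_nth (infixl "$" 75)

section \<open>Primitive triples modulo a linear form\<close>

text \<open>Up to a unit, the gcd of the three products is \<open>b\<close> times the gcd of the
  three cofactors.\<close>

lemma dvd_if_dvd_mult_coprime3:
  fixes a b c1 c2 c3 :: "'a::{factorial_ring_gcd, semiring_gcd_mult_normalize}"
  assumes "a dvd b * c1" "a dvd b * c2" "a dvd b * c3"
    and "is_unit (gcd c1 (gcd c2 c3))"
  shows "a dvd b"
proof -
  have "a dvd gcd (b * c1) (gcd (b * c2) (b * c3))"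
    using assms by simp
  also have "gcd (b * c1) (gcd (b * c2) (b * c3)) = normalize (b * gcd c1 (gcd c2 c3))"
    by (simp add: gcd_mult_left)
  finally show ?thesis
    using assms(4) by (simp add: dvd_mult_unit_iff)
qed

lemma is_unit_gcd3_if_no_prime:
  fixes c1 c2 c3 :: "'a::factorial_ring_gcd"
  assumes "c1 \<noteq> 0"
    and "\<And>p. prime p \<Longrightarrow> p dvd c1 \<Longrightarrow> p dvd c2 \<Longrightarrow> p dvd c3 \<Longrightarrow> False"
  shows "is_unit (gcd c1 (gcd c2 c3))"
proof (rule ccontr)
  assume "\<not> is_unit (gcd c1 (gcd c2 c3))"
  moreover have "gcd c1 (gcd c2 c3) \<noteq> 0" using assms(1) by simp
  ultimately obtain p where "p dvd gcd c1 (gcd c2 c3)" "prime p"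
    using prime_divisor_exists by blast
  then show False using assms(2)[of p] by simp
qed

text \<open>Dividing by the gcd \<open>r\<close> makes \<open>v\<close> coprime. If
  \<open>v1\<close> is nonzero, proportionality makes \<open>v1\<close> divide \<open>w1\<close>
  times each entry of \<open>v\<close>, hence \<open>w1\<close>, and the quotient is
  \<open>s\<close>; otherwise the entries are permuted.\<close>

lemma primitive_triple_exists:
  fixes u1 u2 u3 :: "'a::{factorial_ring_gcd, semiring_gcd_mult_normalize}"
  assumes "u1 \<noteq> 0 \<or> u2 \<noteq> 0 \<or> u3 \<noteq> 0"
  obtains r v1 v2 v3 where "u1 = r * v1" "u2 = r * v2" "u3 = r * v3"
    "\<And>w1 w2 w3. \<lbrakk>w1 * v2 = w2 * v1; w1 * v3 = w3 * v1; w2 * v3 = w3 * v2\<rbrakk>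
      \<Longrightarrow> \<exists>s. w1 = s * v1 \<and> w2 = s * v2 \<and> w3 = s * v3"
proof -
  define r where "r = gcd u1 (gcd u2 u3)"
  have r0: "r \<noteq> 0" using assms by (auto simp: r_def)
  have "r dvd u1" "r dvd u2" "r dvd u3" by (simp_all add: r_def gcd_dvdI2)
  then obtain v1 v2 v3 where v: "u1 = r * v1" "u2 = r * v2" "u3 = r * v3"
    by (auto elim!: dvdE)
  have "r = gcd (r * v1) (gcd (r * v2) (r * v3))"
    using r_def[unfolded v] .
  also have "\<dots> = normalize (r * gcd v1 (gcd v2 v3))"
    by (simp add: gcd_mult_left)
  also have "\<dots> = r * gcd v1 (gcd v2 v3)"
    by (simp add: normalize_mult r_def)
  finally have gu: "is_unit (gcd v1 (gcd v2 v3))" using r0 by simp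
  have key: "\<exists>s. w1 = s * v1 \<and> w2 = s * v2 \<and> w3 = s * v3"
    if "w1 * v2 = w2 * v1" "w1 * v3 = w3 * v1" "w2 * v3 = w3 * v2" "v1 \<noteq> 0"
      "is_unit (gcd v1 (gcd v2 v3))" for v1 v2 v3 w1 w2 w3 :: 'a
  proof -
    have "v1 dvd w1"
      by (rule dvd_if_dvd_mult_coprime3[OF _ _ _ that(5)]) (auto simp: that)
    then obtain s where s: "w1 = s * v1" by (metis dvdE mult.commute)
    have "v1 * w2 = v1 * (s * v2)" "v1 * w3 = v1 * (s * v3)"
      using that s by (auto simp: mult_ac)
    then show ?thesis using s \<open>v1 \<noteq> 0\<close> by auto
  qed
  have "v1 \<noteq> 0 \<or> v2 \<noteq> 0 \<or> v3 \<noteq> 0" using gu by auto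
  then have "\<exists>s. w1 = s * v1 \<and> w2 = s * v2 \<and> w3 = s * v3"
    if "w1 * v2 = w2 * v1" "w1 * v3 = w3 * v1" "w2 * v3 = w3 * v2" for w1 w2 w3
  proof (elim disjE)
    assume "v1 \<noteq> 0" then show ?thesis using key that gu by blast
  next
    assume "v2 \<noteq> 0"
    then show ?thesis using key[of w2 v1 w1 v2 v3 w3] that gu
      by (auto simp: gcd.left_commute)
  next
    assume "v3 \<noteq> 0"
    then show ?thesis using key[of w3 v1 w1 v3 v2 w2] that gu
      by (auto simp: gcd.left_commute gcd.commute)
  qed
  with v show thesis using that by blast
qed

text \<open>Realises the quotient by \<open>g\<close> as an existing type: with target
  \<open>complex poly poly\<close>, factoriality of \<open>S/g\<close> comes from the type class.
  Preservation of 1 follows from surjectivity.\<close>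

definition quotient_hom :: "('a::comm_ring_1 \<Rightarrow> 'b::comm_ring_1) \<Rightarrow> 'a \<Rightarrow> bool" where
  "quotient_hom \<phi> g \<longleftrightarrow> (\<forall>p q. \<phi> (p + q) = \<phi> p + \<phi> q) \<and> (\<forall>p q. \<phi> (p * q) = \<phi> p * \<phi> q) \<and>
     surj \<phi> \<and> (\<forall>p. \<phi> p = 0 \<longleftrightarrow> g dvd p)"

text \<open>The linear polynomial is a unit times \<open>[:- l, 1:]\<close>, so reducing modulo it
  means substituting \<open>l\<close>.\<close>

lemma quotient_hom_eval:
  fixes c l :: "'a::{algebraic_semidom, idom_divide}"
  assumes "is_unit c"
  shows "quotient_hom (\<lambda>p. poly p l) [:- (c * l), c:]"
proof -
  have "[:- (c * l), c:] = [:c:] * [:- l, 1:]" by simp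
  moreover have "is_unit [:c:]" using assms by (simp add: is_unit_const_poly_iff)
  ultimately have "[:- (c * l), c:] dvd p \<longleftrightarrow> [:- l, 1:] dvd p" for p
    by (metis mult_unit_dvd_iff')
  moreover have "surj (\<lambda>p. poly p l)"
    by (rule surjI[where f = "\<lambda>c. [:c:]"]) simp
  ultimately show ?thesis
    by (simp add: quotient_hom_def poly_eq_0_iff_dvd)
qed

lemma quotient_hom_map_poly:
  fixes \<phi> :: "'a::idom \<Rightarrow> 'b::idom"
  assumes "quotient_hom \<phi> g"
  shows "quotient_hom (map_poly \<phi>) [:g:]"
proof -
  have add: "\<phi> (p + q) = \<phi> p + \<phi> q" and mult: "\<phi> (p * q) = \<phi> p * \<phi> q"
    and ker: "\<phi> p = 0 \<longleftrightarrow> g dvd p" and "surj \<phi>" for p q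
    using assms by (auto simp: quotient_hom_def)
  have zero: "\<phi> 0 = 0" using ker by simp
  have sum: "\<phi> (sum h A) = (\<Sum>i\<in>A. \<phi> (h i))" for h and A :: "nat set"
    by (induction A rule: infinite_finite_induct) (simp_all add: zero add)
  \<comment> \<open>The section must send 0 to 0, so that it acts correctly on vanishing
    coefficients as well.\<close>
  define \<psi> where "\<psi> b = (if b = 0 then 0 else inv \<phi> b)" for b
  have "\<phi> (\<psi> b) = b" for b
    using \<open>surj \<phi>\<close> by (simp add: \<psi>_def zero surj_f_inv_f)
  moreover have "\<psi> 0 = 0" by (simp add: \<psi>_def)
  ultimately have "map_poly \<phi> (map_poly \<psi> p) = p" for p
    by (intro poly_eqI) (simp add: coeff_map_poly zero)
  then have "surj (map_poly \<phi>)" by (metis surjI)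
  moreover have "map_poly \<phi> p = 0 \<longleftrightarrow> [:g:] dvd p" for p
    by (simp add: poly_eq_iff coeff_map_poly zero ker const_poly_dvd_iff)
  moreover have "map_poly \<phi> (p + q) = map_poly \<phi> p + map_poly \<phi> q" for p q
    by (intro poly_eqI) (simp add: coeff_map_poly zero add)
  moreover have "map_poly \<phi> (p * q) = map_poly \<phi> p * map_poly \<phi> q" for p q
    by (intro poly_eqI) (simp add: coeff_map_poly zero coeff_mult sum mult)
  ultimately show ?thesis by (simp add: quotient_hom_def)
qed

section \<open>Linear forms and their quotient rings\<close>

lemma mcoeff_eqI: "(\<And>i j k. mcoeff p i j k = mcoeff q i j k) \<Longrightarrow> p = q"
  by (simp add: mcoeff_def poly_eq_iff)

lemma mcoeff_add: "mcoeff (p + q) i j k = mcoeff p i j k + mcoeff q i j k"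
  by (simp add: mcoeff_def)

lemma mcoeff_sum: "mcoeff (sum h A) i j k = (\<Sum>a\<in>A. mcoeff (h a) i j k)"
  by (simp add: mcoeff_def coeff_sum)

lemma linear_form_eq:
  assumes "homogeneous 1 g"
  obtains a b c where "g = [:[:[:0, a:], [:b:]:], [:[:c:]:]:]"
proof -
  have hom: "mcoeff g i j k = 0" if "i + j + k \<noteq> 1" for i j k
    using assms that by (auto simp: homogeneous_def)
  have "g = [:[:[:0, mcoeff g 1 0 0:], [:mcoeff g 0 1 0:]:], [:[:mcoeff g 0 0 1:]:]:]"
    (is "g = ?r")
  proof (rule mcoeff_eqI)
    fix i j k
    show "mcoeff g i j k = mcoeff ?r i j k"
    proof (cases "i + j + k = 1")
      case True
      then consider "i = 1 \<and> j = 0 \<and> k = 0" | "i = 0 \<and> j = 1 \<and> k = 0" | "i = 0 \<and> j = 0 \<and> k = 1"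
        by linarith
      then show ?thesis
        by cases (simp_all add: mcoeff_def coeff_pCons)
    next
      case False
      then have "mcoeff ?r i j k = 0"
        by (auto simp: mcoeff_def coeff_pCons split: nat.splits)
      then show ?thesis using hom[OF False] by simp
    qed
  qed
  then show thesis using that by blast
qed

text \<open>Solve \<open>g = 0\<close> for the outermost variable that occurs: \<open>z\<close>,
  else \<open>y\<close>, else \<open>x\<close>. Substitution eliminates it, and
  \<open>map_poly\<close> carries the substitution through the variables outside it.\<close>

lemma linear_form_quotient_hom:
  assumes "homogeneous 1 g" "g \<noteq> 0"
  obtains \<phi> :: "S \<Rightarrow> complex poly poly" where "quotient_hom \<phi> g"
proof -
  obtain a b c where g: "g = [:[:[:0, a:], [:b:]:], [:[:c:]:]:]"
    using assms(1) by (rule linear_form_eq)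
  consider "c \<noteq> 0" | "c = 0" "b \<noteq> 0" | "c = 0" "b = 0" "a \<noteq> 0"
    using assms(2) g by fastforce
  then show thesis
  proof cases
    case 1
    then have "is_unit [:[:c:]:]" by (simp add: is_unit_const_poly_iff dvd_field_iff)
    from quotient_hom_eval[OF this, of "[:[:0, - (a / c):], [:- (b / c):]:]"]
    show thesis using 1 that by (simp add: g)
  next
    case 2
    then have "is_unit [:b:]" by (simp add: is_unit_const_poly_iff dvd_field_iff)
    from quotient_hom_map_poly[OF quotient_hom_eval[OF this, of "[:0, - (a / b):]"]]
    show thesis using 2 that by (simp add: g)
  next
    case 3
    then have "is_unit a" by (simp add: dvd_field_iff)
    from quotient_hom_map_poly[OF quotient_hom_map_poly[OF quotient_hom_eval[OF this, of 0]]]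
    show thesis using 3 that by (simp add: g)
  qed
qed

text \<open>The target of the quotient map is an integral domain, and a preimage of 1 shows that
  \<open>g\<close> is not a unit.\<close>

lemma linear_form_prime:
  assumes "homogeneous 1 g" "g \<noteq> 0"
  shows "prime_elem g"
proof -
  obtain \<phi> :: "S \<Rightarrow> complex poly poly" where \<phi>: "quotient_hom \<phi> g"
    using linear_form_quotient_hom[OF assms] .
  then have mult: "\<phi> (p * q) = \<phi> p * \<phi> q" and ker: "\<phi> p = 0 \<longleftrightarrow> g dvd p" and "surj \<phi>" for p q
    by (auto simp: quotient_hom_def)
  obtain p where "\<phi> p = 1" using \<open>surj \<phi>\<close> by (metis surjD)
  then have "\<not> g dvd p" by (simp flip: ker)
  then have "\<not> is_unit g" by (meson dvd_trans one_dvd)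
  then show ?thesis
    using assms(2) by (auto simp: prime_elem_def mult simp flip: ker)
qed

text \<open>This is \<open>primitive_triple_exists\<close> in the factorial ring \<open>S/g\<close>,
  lifted back along the quotient map so that equations become congruences.\<close>

lemma primitive_triple_mod_linear_form:
  assumes "homogeneous 1 g" "g \<noteq> 0" and "\<not> (g dvd a1 \<and> g dvd a2 \<and> g dvd a3)"
  obtains r v1 v2 v3 where "g dvd a1 - r * v1" "g dvd a2 - r * v2" "g dvd a3 - r * v3"
    "\<And>w1 w2 w3. \<lbrakk>g dvd w1 * v2 - w2 * v1; g dvd w1 * v3 - w3 * v1; g dvd w2 * v3 - w3 * v2\<rbrakk>
      \<Longrightarrow> \<exists>s. g dvd w1 - s * v1 \<and> g dvd w2 - s * v2 \<and> g dvd w3 - s * v3"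
proof -
  obtain \<phi> :: "S \<Rightarrow> complex poly poly" where \<phi>: "quotient_hom \<phi> g"
    using linear_form_quotient_hom[OF assms(1,2)] .
  then have add: "\<phi> (p + q) = \<phi> p + \<phi> q" and mult: "\<phi> (p * q) = \<phi> p * \<phi> q"
    and ker: "\<phi> p = 0 \<longleftrightarrow> g dvd p" and "surj \<phi>" for p q
    by (auto simp: quotient_hom_def)
  have cong: "g dvd p - q \<longleftrightarrow> \<phi> p = \<phi> q" for p q
    using add[of "p - q" q] by (simp flip: ker)
  have "\<phi> a1 \<noteq> 0 \<or> \<phi> a2 \<noteq> 0 \<or> \<phi> a3 \<noteq> 0" using assms(3) by (simp add: ker)
  then obtain r v1 v2 v3 where *: "\<phi> a1 = r * v1" "\<phi> a2 = r * v2" "\<phi> a3 = r * v3"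
    "\<And>w1 w2 w3. \<lbrakk>w1 * v2 = w2 * v1; w1 * v3 = w3 * v1; w2 * v3 = w3 * v2\<rbrakk>
      \<Longrightarrow> \<exists>s. w1 = s * v1 \<and> w2 = s * v2 \<and> w3 = s * v3"
    by (rule primitive_triple_exists) (rule that)
  obtain r' v1' v2' v3' where lifts: "r = \<phi> r'" "v1 = \<phi> v1'" "v2 = \<phi> v2'" "v3 = \<phi> v3'"
    using \<open>surj \<phi>\<close> by (metis surjD)
  show thesis
  proof (rule that)
    show "g dvd a1 - r' * v1'" "g dvd a2 - r' * v2'" "g dvd a3 - r' * v3'"
      using * by (simp_all add: cong mult lifts)
    fix w1 w2 w3
    assume "g dvd w1 * v2' - w2 * v1'" "g dvd w1 * v3' - w3 * v1'" "g dvd w2 * v3' - w3 * v2'"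
    then obtain s where s: "\<phi> w1 = s * v1" "\<phi> w2 = s * v2" "\<phi> w3 = s * v3"
      using *(4)[of "\<phi> w1" "\<phi> w2" "\<phi> w3"] by (auto simp: cong mult lifts)
    obtain s' where "s = \<phi> s'" using \<open>surj \<phi>\<close> by (metis surjD)
    then show "\<exists>s. g dvd w1 - s * v1' \<and> g dvd w2 - s * v2' \<and> g dvd w3 - s * v3'"
      using s by (auto simp: cong mult lifts)
  qed
qed

section \<open>The gradient of a reduced curve\<close>

lemma map_poly_leibniz:
  fixes \<delta> :: "'a::comm_ring_1 \<Rightarrow> 'a"
  assumes add: "\<And>p q. \<delta> (p + q) = \<delta> p + \<delta> q"
    and leibniz: "\<And>p q. \<delta> (p * q) = p * \<delta> q + \<delta> p * q"
  shows "map_poly \<delta> (p * q) = p * map_poly \<delta> q + map_poly \<delta> p * q"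
proof -
  have zero: "\<delta> 0 = 0" using add[of 0 0] by simp
  have sum: "\<delta> (sum h A) = (\<Sum>i\<in>A. \<delta> (h i))" for h and A :: "nat set"
    by (induction A rule: infinite_finite_induct) (simp_all add: zero add)
  show ?thesis
    by (intro poly_eqI) (simp add: coeff_map_poly zero coeff_mult sum leibniz sum.distrib)
qed

lemma map_poly_additive:
  assumes "\<And>p q. \<delta> (p + q) = \<delta> p + \<delta> q" and "\<delta> 0 = 0"
  shows "map_poly \<delta> (p + q) = map_poly \<delta> p + map_poly \<delta> q"
  by (intro poly_eqI) (simp add: coeff_map_poly assms)

lemma pderiv_leibniz: "pderiv (p * q) = p * pderiv q + pderiv p * q"
  by (simp add: pderiv_mult mult.commute)

lemma d_leibniz:
  "d_x (p * q) = p * d_x q + d_x p * q"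
  "d_y (p * q) = p * d_y q + d_y p * q"
  "d_z (p * q) = p * d_z q + d_z p * q"
  unfolding d_x_def d_y_def d_z_def
  by (intro map_poly_leibniz map_poly_additive pderiv_leibniz pderiv_add map_poly_0 pderiv_0)+

lemma dvd_pderiv_imp_degree_0:
  fixes p :: "'a::{idom, semiring_char_0} poly"
  assumes "p dvd pderiv p"
  shows "degree p = 0"
proof (rule ccontr)
  assume "degree p \<noteq> 0"
  then have "pderiv p \<noteq> 0" by (simp add: pderiv_eq_0_iff)
  with assms have "degree p \<le> degree (pderiv p)" by (rule dvd_imp_degree_le)
  with \<open>degree p \<noteq> 0\<close> show False by (simp add: degree_pderiv)
qed

text \<open>In characteristic zero a polynomial of positive degree has a nonzero derivative of
  smaller degree, so \<open>p\<close> involves neither \<open>z\<close> nor, successively,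
  \<open>y\<close> and \<open>x\<close>.\<close>

lemma is_unit_if_dvd_partials:
  assumes "p \<noteq> 0" "p dvd d_x p" "p dvd d_y p" "p dvd d_z p"
  shows "is_unit p"
proof -
  obtain q where q: "p = [:q:]"
    using assms(4) dvd_pderiv_imp_degree_0 degree_0_id unfolding d_z_def by metis
  then have "q dvd pderiv q"
    using assms(3) by (simp add: d_y_def map_poly_pCons)
  then obtain r where r: "q = [:r:]"
    using dvd_pderiv_imp_degree_0 degree_0_id by metis
  then have "r dvd pderiv r"
    using assms(2) q by (simp add: d_x_def map_poly_pCons)
  then obtain c where "r = [:c:]"
    using dvd_pderiv_imp_degree_0 degree_0_id by metis
  then show ?thesis
    using assms(1) q r by (simp add: is_unit_const_poly_iff dvd_field_iff)
qed

lemma mcoeff_var_mult: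
  "mcoeff (var_x * p) i j k = (case i of 0 \<Rightarrow> 0 | Suc i \<Rightarrow> mcoeff p i j k)"
  "mcoeff (var_y * p) i j k = (case j of 0 \<Rightarrow> 0 | Suc j \<Rightarrow> mcoeff p i j k)"
  "mcoeff (var_z * p) i j k = (case k of 0 \<Rightarrow> 0 | Suc k \<Rightarrow> mcoeff p i j k)"
  by (simp_all add: mcoeff_def var_x_def var_y_def var_z_def coeff_pCons split: nat.splits)

lemma mcoeff_of_nat_mult: "mcoeff (of_nat n * p) i j k = of_nat n * mcoeff p i j k"
  by (simp add: mcoeff_def of_nat_poly)

text \<open>A partial derivative times its variable scales each monomial by the exponent, and the
  three exponents add up to \<open>d\<close>.\<close>

lemma euler_identity:
  assumes "homogeneous d f"
  shows "var_x * d_x f + var_y * d_y f + var_z * d_z f = of_nat d * f"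
proof (rule mcoeff_eqI)
  fix i j k
  have "mcoeff (var_x * d_x f + var_y * d_y f + var_z * d_z f) i j k = of_nat (i + j + k) * mcoeff f i j k"
    by (simp add: mcoeff_add mcoeff_var_mult mcoeff_d algebra_simps split: nat.split)
  also have "\<dots> = mcoeff (of_nat d * f) i j k"
    using assms by (cases "mcoeff f i j k = 0") (auto simp: mcoeff_of_nat_mult homogeneous_def)
  finally show "mcoeff (var_x * d_x f + var_y * d_y f + var_z * d_z f) i j k = mcoeff (of_nat d * f) i j k" .
qed

lemma is_unit_of_nat_S: "n > 0 \<Longrightarrow> is_unit (of_nat n :: S)"
  by (simp add: of_nat_poly is_unit_const_poly_iff dvd_field_iff)

text \<open>A common prime factor \<open>p\<close> of the partials divides \<open>f\<close> by
  Euler's identity. In \<open>f = p * q\<close> squarefreeness keeps \<open>p\<close> from dividing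
  \<open>q\<close>, so Leibniz makes \<open>p\<close> divide its own partials, and \<open>p\<close>
  would be a unit.\<close>

lemma reduced_curve_gradient_coprime:
  assumes "reduced_curve f"
  shows "is_unit (gcd (d_x f) (gcd (d_y f) (d_z f)))"
proof -
  obtain d where f0: "f \<noteq> 0" and d: "d \<ge> 1" "homogeneous d f" and sq: "squarefree f"
    using assms by (auto simp: reduced_curve_def)
  have False if p: "prime p" "p dvd d_x f" "p dvd d_y f" "p dvd d_z f" for p
  proof -
    have "p dvd of_nat d * f"
      unfolding euler_identity[OF d(2), symmetric] using p by auto
    with d(1) have "p dvd f"
      by (simp add: dvd_mult_unit_iff' is_unit_of_nat_S)
    then obtain q where q: "f = p * q" by (auto elim: dvdE)
    have "\<not> p dvd q"
    proof
      assume "p dvd q"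
      then have "p\<^sup>2 dvd f" by (simp add: q power2_eq_square)
      with sq have "is_unit p" by (simp add: squarefree_def)
      with p(1) show False by auto
    qed
    moreover have "p dvd q * d_x p" "p dvd q * d_y p" "p dvd q * d_z p"
      using p(2-4) by (simp_all add: q d_leibniz dvd_add_right_iff mult.commute)
    ultimately have "p dvd d_x p" "p dvd d_y p" "p dvd d_z p"
      using p(1) by (auto simp: prime_dvd_mult_iff)
    then have "is_unit p" using p(1) by (intro is_unit_if_dvd_partials) auto
    with p(1) show False by auto
  qed
  \<comment> \<open>The gcd criterion asks for a nonzero first entry; Euler's identity provides a
    nonzero partial, and each position of it calls for its own ordering.\<close>
  moreover have "d_x f \<noteq> 0 \<or> d_y f \<noteq> 0 \<or> d_z f \<noteq> 0"
    using euler_identity[OF d(2)] f0 d(1) by auto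
  ultimately show ?thesis
    using is_unit_gcd3_if_no_prime[of "d_x f" "d_y f" "d_z f"]
      is_unit_gcd3_if_no_prime[of "d_y f" "d_x f" "d_z f"]
      is_unit_gcd3_if_no_prime[of "d_z f" "d_x f" "d_y f"]
    by (metis gcd.commute gcd.left_commute)
qed

section \<open>Homogeneous components\<close>

text \<open>The sum runs over the exponents \<open>k\<close> of \<open>z\<close> and
  \<open>j\<close> of \<open>y\<close>; the exponent of \<open>x\<close> is then
  \<open>n - k - j\<close>, and in these ranges no subtraction is truncated.\<close>

definition hom_part :: "nat \<Rightarrow> S \<Rightarrow> S" where
  "hom_part n p = (\<Sum>k\<le>n. monom (\<Sum>j\<le>n - k. monom (monom (mcoeff p (n - k - j) j k) (n - k - j)) j) k)"

lemma mcoeff_hom_part: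
  "mcoeff (hom_part n p) i j k = (if i + j + k = n then mcoeff p i j k else 0)"
proof -
  have "coeff (hom_part n p) k =
      (if k \<le> n then \<Sum>j\<le>n - k. monom (monom (mcoeff p (n - k - j) j k) (n - k - j)) j else 0)"
    by (simp add: hom_part_def coeff_sum)
  then have "coeff (coeff (hom_part n p) k) j =
      (if k \<le> n \<and> j \<le> n - k then monom (mcoeff p (n - k - j) j k) (n - k - j) else 0)"
    by (simp add: coeff_sum)
  then show ?thesis
    by (auto simp: mcoeff_def[of "hom_part n p"])
qed

lemma mcoeff_0 [simp]: "mcoeff 0 i j k = 0"
  by (simp add: mcoeff_def)

lemma homogeneous_0 [simp]: "homogeneous d 0"
  by (simp add: homogeneous_def)

lemma homogeneous_hom_part [simp]: "homogeneous n (hom_part n p)"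
  by (simp add: homogeneous_def mcoeff_hom_part)

lemma hom_part_0 [simp]: "hom_part n 0 = 0"
  by (rule mcoeff_eqI) (simp add: mcoeff_hom_part)

lemma hom_part_add: "hom_part n (p + q) = hom_part n p + hom_part n q"
  by (rule mcoeff_eqI) (simp add: mcoeff_hom_part mcoeff_add)

lemma hom_part_sum: "hom_part n (sum h A) = (\<Sum>a\<in>A. hom_part n (h a))"
  by (induction A rule: infinite_finite_induct) (simp_all add: hom_part_add)

lemma hom_part_homogeneous: "homogeneous d p \<Longrightarrow> hom_part n p = (if n = d then p else 0)"
  by (rule mcoeff_eqI) (auto simp: mcoeff_hom_part homogeneous_def)

lemma mcoeff_mult:
  "mcoeff (p * q) i j k =
    (\<Sum>k'\<le>k. \<Sum>j'\<le>j. \<Sum>i'\<le>i. mcoeff p i' j' k' * mcoeff q (i - i') (j - j') (k - k'))"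
  by (simp add: mcoeff_def coeff_mult coeff_sum)

lemma homogeneous_mult:
  assumes "homogeneous a p" "homogeneous b q"
  shows "homogeneous (a + b) (p * q)"
  unfolding homogeneous_def
proof (intro allI impI)
  fix i j k
  assume "mcoeff (p * q) i j k \<noteq> 0"
  then obtain i' j' k' where "i' \<le> i" "j' \<le> j" "k' \<le> k"
    and "mcoeff p i' j' k' \<noteq> 0" "mcoeff q (i - i') (j - j') (k - k') \<noteq> 0"
    unfolding mcoeff_mult by (metis (no_types, lifting) atMost_iff mult_eq_0_iff sum.neutral)
  with assms show "i + j + k = a + b"
    by (fastforce simp: homogeneous_def)
qed

lemma degree_bound_exists: "\<exists>N. \<forall>i j k. mcoeff p i j k \<noteq> 0 \<longrightarrow> i + j + k \<le> N"
proof -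
  define A where "A = (SIGMA k:{..degree p}. SIGMA j:{..degree (coeff p k)}. {..degree (coeff (coeff p k) j)})"
  have "finite ((\<lambda>(k, j, i). i + j + k) ` A)"
    by (simp add: A_def)
  then obtain N where N: "\<forall>m\<in>(\<lambda>(k, j, i). i + j + k) ` A. m \<le> N"
    unfolding finite_nat_set_iff_bounded_le ..
  have "i + j + k \<le> N" if "mcoeff p i j k \<noteq> 0" for i j k
  proof -
    have "coeff (coeff (coeff p k) j) i \<noteq> 0" using that by (simp add: mcoeff_def)
    then have "(k, j, i) \<in> A"
      unfolding A_def by (auto intro!: le_degree)
    with N show ?thesis by force
  qed
  then show ?thesis by blast
qed

text \<open>Allowing every large \<open>M\<close> lets the three coordinates of a derivation share
  one bound and lets the sum be extended past a given degree.\<close>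

lemma sum_hom_part: "\<exists>N. \<forall>M\<ge>N. p = (\<Sum>n\<le>M. hom_part n p)"
proof -
  obtain N where N: "\<And>i j k. mcoeff p i j k \<noteq> 0 \<Longrightarrow> i + j + k \<le> N"
    using degree_bound_exists[of p] by blast
  have "p = (\<Sum>n\<le>M. hom_part n p)" if "M \<ge> N" for M
  proof (rule mcoeff_eqI)
    fix i j k
    show "mcoeff p i j k = mcoeff (\<Sum>n\<le>M. hom_part n p) i j k"
      using N[of i j k] that by (cases "mcoeff p i j k = 0") (auto simp: mcoeff_sum mcoeff_hom_part)
  qed
  then show ?thesis by blast
qed

lemma hom_part_mult_homogeneous:
  assumes "homogeneous d q"
  shows "hom_part n (p * q) = (if d \<le> n then hom_part (n - d) p * q else 0)"
proof -
  obtain N where N: "\<And>M. M \<ge> N \<Longrightarrow> p = (\<Sum>m\<le>M. hom_part m p)"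
    using sum_hom_part[of p] by blast
  have "hom_part n (p * q) = hom_part n (\<Sum>m\<le>max N n. hom_part m p * q)"
    unfolding sum_distrib_right[symmetric] using N[of "max N n"] by simp
  also have "\<dots> = (\<Sum>m\<le>max N n. if n = m + d then hom_part m p * q else 0)"
    unfolding hom_part_sum
    by (intro sum.cong refl hom_part_homogeneous homogeneous_mult homogeneous_hom_part assms)
  also have "\<dots> = (\<Sum>m\<le>max N n. if m = n - d then (if d \<le> n then hom_part m p * q else 0) else 0)"
    by (rule sum.cong) auto
  also have "\<dots> = (if d \<le> n then hom_part (n - d) p * q else 0)"
    by (subst sum.delta) auto
  finally show ?thesis .
qed

lemma hom_part_mult: "hom_part n (p * q) = (\<Sum>j\<le>n. hom_part j p * hom_part (n - j) q)"
proof -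
  obtain N where N: "\<And>M. M \<ge> N \<Longrightarrow> p = (\<Sum>m\<le>M. hom_part m p)"
    using sum_hom_part[of p] by blast
  have "hom_part n (p * q) = hom_part n (\<Sum>j\<le>max N n. q * hom_part j p)"
    unfolding sum_distrib_left[symmetric] using N[of "max N n"] by (simp add: mult.commute)
  also have "\<dots> = (\<Sum>j\<le>max N n. if j \<le> n then hom_part j p * hom_part (n - j) q else 0)"
    unfolding hom_part_sum
    by (intro sum.cong refl) (simp add: hom_part_mult_homogeneous[OF homogeneous_hom_part] mult.commute)
  also have "\<dots> = (\<Sum>j\<le>n. hom_part j p * hom_part (n - j) q)"
    by (intro sum.mono_neutral_cong_right) auto
  finally show ?thesis .
qed

section \<open>Graded components of derivations\<close>

definition der_part :: "nat \<Rightarrow> Der \<Rightarrow> Der" where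
  "der_part n \<theta> = (\<chi> i. hom_part n (\<theta> $ i))"

lemma der_part_0 [simp]: "der_part n 0 = 0"
  by (simp add: der_part_def vec_eq_iff)

lemma der_part_add: "der_part n (u + v) = der_part n u + der_part n v"
  by (simp add: der_part_def vec_eq_iff hom_part_add)

lemma der_part_uminus: "der_part n (- u) = - der_part n u"
  using der_part_add[of n u "- u"] by (simp add: minus_unique)

lemma der_part_sum: "der_part n (sum h A) = (\<Sum>a\<in>A. der_part n (h a))"
  by (induction A rule: infinite_finite_induct) (simp_all add: der_part_add)

lemma homogeneous_der_part [simp]: "homogeneous_der n (der_part n \<theta>)"
  by (simp add: homogeneous_der_def der_part_def)

lemma der_part_homogeneous: "homogeneous_der e \<theta> \<Longrightarrow> der_part n \<theta> = (if n = e then \<theta> else 0)"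
  by (simp add: homogeneous_der_def der_part_def vec_eq_iff hom_part_homogeneous[of e])

lemma der_part_scale: "der_part n (p *s \<theta>) = (\<Sum>j\<le>n. hom_part j p *s der_part (n - j) \<theta>)"
  by (simp add: der_part_def vec_eq_iff hom_part_mult)

lemma der_part_scale_homogeneous:
  "homogeneous_der e \<theta> \<Longrightarrow> der_part n (p *s \<theta>) = (if e \<le> n then hom_part (n - e) p *s \<theta> else 0)"
  by (simp add: homogeneous_der_def der_part_def vec_eq_iff hom_part_mult_homogeneous[of e])

lemma sum_der_part: "\<exists>N. \<theta> = (\<Sum>n\<le>N. der_part n \<theta>)"
proof -
  have "\<forall>i. \<exists>N. \<forall>M\<ge>N. \<theta> $ i = (\<Sum>n\<le>M. hom_part n (\<theta> $ i))"
    using sum_hom_part by blast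
  then obtain N where N: "\<And>i M. M \<ge> N i \<Longrightarrow> \<theta> $ i = (\<Sum>n\<le>M. hom_part n (\<theta> $ i))"
    by metis
  have "\<theta> = (\<Sum>n\<le>(\<Sum>i\<in>UNIV. N i). der_part n \<theta>)"
    unfolding vec_eq_iff
  proof
    fix i
    have "N i \<le> (\<Sum>i\<in>UNIV. N i)" by (rule member_le_sum) auto
    from N[OF this] show "\<theta> $ i = (\<Sum>n\<le>(\<Sum>i\<in>UNIV. N i). der_part n \<theta>) $ i"
      by (simp add: der_part_def)
  qed
  then show ?thesis ..
qed

lemma homogeneous_partials:
  assumes "homogeneous d f"
  shows "homogeneous (d - 1) (d_x f)" "homogeneous (d - 1) (d_y f)" "homogeneous (d - 1) (d_z f)"
proof -
  have *: "i + j + k = d" if "mcoeff f i j k \<noteq> 0" for i j k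
    using assms that by (simp add: homogeneous_def)
  show "homogeneous (d - 1) (d_x f)" "homogeneous (d - 1) (d_y f)" "homogeneous (d - 1) (d_z f)"
    unfolding homogeneous_def mcoeff_d
    using *[of "Suc _"] *[of _ "Suc _"] *[of _ _ "Suc _"] by fastforce+
qed

text \<open>The partials of \<open>f\<close> have degree \<open>d - 1\<close>, so a component of
  \<open>\<theta>\<close> applied to \<open>f\<close> is a component of \<open>b * f\<close>; as
  \<open>f\<close> is homogeneous, that is again a multiple of \<open>f\<close>.\<close>

lemma der_part_in_D:
  assumes "homogeneous d f" "\<theta> \<in> D f"
  shows "der_part n \<theta> \<in> D f"
proof -
  obtain b where b: "der_apply \<theta> f = b * f"
    using assms(2) unfolding D_def by (metis dvdE mem_Collect_eq mult.commute)
  have "der_apply (der_part n \<theta>) f = hom_part (n + (d - 1)) (der_apply \<theta> f)"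
    using homogeneous_partials[OF assms(1)]
    by (simp add: der_apply_def der_part_def hom_part_add hom_part_mult_homogeneous)
  also have "f dvd \<dots>"
    unfolding b using assms(1) by (simp add: hom_part_mult_homogeneous)
  finally show ?thesis by (simp add: D_def)
qed

lemma der_apply_linear:
  "der_apply (u + v) f = der_apply u f + der_apply v f"
  "der_apply (a *s u) f = a * der_apply u f"
  by (simp_all add: der_apply_def algebra_simps)

lemma subspace_D: "der.subspace (D f)"
  by (rule der.subspaceI)
    (simp_all add: D_def der_apply_linear, simp add: der_apply_def)

section \<open>Saito's determinants\<close>

lemma det_coeff_matrix:
  "det (coeff_matrix u v w) =
    u $ 1 * (v $ 2 * w $ 3 - v $ 3 * w $ 2) - u $ 2 * (v $ 1 * w $ 3 - v $ 3 * w $ 1)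
    + u $ 3 * (v $ 1 * w $ 2 - v $ 2 * w $ 1)"
  by (simp add: coeff_matrix_def det_3 algebra_simps)

lemma det_coeff_matrix_linear:
  "det (coeff_matrix (u + u') v w) = det (coeff_matrix u v w) + det (coeff_matrix u' v w)"
  "det (coeff_matrix u (v + v') w) = det (coeff_matrix u v w) + det (coeff_matrix u v' w)"
  "det (coeff_matrix u v (w + w')) = det (coeff_matrix u v w) + det (coeff_matrix u v w')"
  "det (coeff_matrix (a *s u) v w) = a * det (coeff_matrix u v w)"
  "det (coeff_matrix u (a *s v) w) = a * det (coeff_matrix u v w)"
  "det (coeff_matrix u v (a *s w)) = a * det (coeff_matrix u v w)"
  "det (coeff_matrix 0 v w) = 0"
  "det (coeff_matrix u 0 w) = 0"
  "det (coeff_matrix u v 0) = 0"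
  by (simp_all add: det_coeff_matrix algebra_simps)

lemma det_coeff_matrix_alternating:
  "det (coeff_matrix u u w) = 0"
  "det (coeff_matrix u v u) = 0"
  "det (coeff_matrix u v v) = 0"
  by (simp_all add: det_coeff_matrix algebra_simps)

lemma det_coeff_matrix_swap:
  "det (coeff_matrix v u w) = - det (coeff_matrix u v w)"
  "det (coeff_matrix u w v) = - det (coeff_matrix u v w)"
  by (simp_all add: det_coeff_matrix algebra_simps)

lemma dvd_det_coeff_matrix_swap:
  "h dvd det (coeff_matrix v u w) \<longleftrightarrow> h dvd det (coeff_matrix u v w)"
  "h dvd det (coeff_matrix u w v) \<longleftrightarrow> h dvd det (coeff_matrix u v w)"
  by (simp_all only: det_coeff_matrix_swap[of v u] det_coeff_matrix_swap(2)[of u w v] dvd_minus_iff)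

text \<open>Cramer's rule with the denominator cleared: coordinates are determinants, which carry a
  factor \<open>f\<close> on \<open>D f\<close>.\<close>

lemma cramer_Der:
  "det (coeff_matrix u v w) *s t =
    det (coeff_matrix t v w) *s u + det (coeff_matrix u t w) *s v + det (coeff_matrix u v t) *s w"
  by (simp add: vec_eq_iff forall_3 det_coeff_matrix algebra_simps)

lemma scale_Der_cancel:
  fixes u v :: Der
  assumes "a \<noteq> 0" "a *s u = a *s v"
  shows "u = v"
  using assms by (simp add: vec_eq_iff)

text \<open>With two arguments fixed, the admissible third ones form a submodule, so the slots pass
  from \<open>T\<close> to its span one after another.\<close>

lemma dvd_det_coeff_matrix_span:
  assumes T: "\<And>u v w. \<lbrakk>u \<in> T; v \<in> T; w \<in> T\<rbrakk> \<Longrightarrow> h dvd det (coeff_matrix u v w)"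
    and "u \<in> der.span T" "v \<in> der.span T" "w \<in> der.span T"
  shows "h dvd det (coeff_matrix u v w)"
proof -
  have 1: "h dvd det (coeff_matrix u v w)" if "u \<in> der.span T" "v \<in> T" "w \<in> T" for u v w
    using that(1)
    by (rule der.span_induct)
      (auto simp: T that det_coeff_matrix_linear intro!: der.subspaceI)
  have 2: "h dvd det (coeff_matrix u v w)" if "u \<in> der.span T" "v \<in> der.span T" "w \<in> T" for u v w
    using that(2)
    by (rule der.span_induct)
      (auto simp: 1 that det_coeff_matrix_linear intro!: der.subspaceI)
  show ?thesis
    using assms(4)
    by (rule der.span_induct)
      (auto simp: 2 assms det_coeff_matrix_linear intro!: der.subspaceI)
qed

text \<open>The determinant times a partial of \<open>f\<close> equals the determinant with the
  corresponding column replaced by the values of \<open>u\<close>, \<open>v\<close>,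
  \<open>w\<close> at \<open>f\<close>, which \<open>f\<close> divides; the partials are
  coprime.\<close>

lemma curve_dvd_det_coeff_matrix:
  assumes "reduced_curve f" "u \<in> D f" "v \<in> D f" "w \<in> D f"
  shows "f dvd det (coeff_matrix u v w)"
proof (rule dvd_if_dvd_mult_coprime3[OF _ _ _ reduced_curve_gradient_coprime[OF assms(1)]])
  have D: "f dvd der_apply u f" "f dvd der_apply v f" "f dvd der_apply w f"
    using assms by (simp_all add: D_def)
  have "det (coeff_matrix u v w) * d_x f =
      der_apply u f * (v $ 2 * w $ 3 - v $ 3 * w $ 2) - der_apply v f * (u $ 2 * w $ 3 - u $ 3 * w $ 2)
      + der_apply w f * (u $ 2 * v $ 3 - u $ 3 * v $ 2)"
    by (simp add: det_coeff_matrix der_apply_def algebra_simps)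
  then show "f dvd det (coeff_matrix u v w) * d_x f" using D by simp
  have "det (coeff_matrix u v w) * d_y f =
      der_apply v f * (u $ 1 * w $ 3 - u $ 3 * w $ 1) - der_apply u f * (v $ 1 * w $ 3 - v $ 3 * w $ 1)
      - der_apply w f * (u $ 1 * v $ 3 - u $ 3 * v $ 1)"
    by (simp add: det_coeff_matrix der_apply_def algebra_simps)
  then show "f dvd det (coeff_matrix u v w) * d_y f" using D by simp
  have "det (coeff_matrix u v w) * d_z f =
      der_apply u f * (v $ 1 * w $ 2 - v $ 2 * w $ 1) - der_apply v f * (u $ 1 * w $ 2 - u $ 2 * w $ 1)
      + der_apply w f * (u $ 1 * v $ 2 - u $ 2 * v $ 1)"
    by (simp add: det_coeff_matrix der_apply_def algebra_simps)
  then show "f dvd det (coeff_matrix u v w) * d_z f" using D by simp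
qed

text \<open>
  The Euler derivation with two of the Koszul derivations \<open>f\<^sub>y\<partial>\<^sub>x - f\<^sub>x\<partial>\<^sub>y\<close>, \<open>f\<^sub>z\<partial>\<^sub>x - f\<^sub>x\<partial>\<^sub>z\<close>,
  \<open>f\<^sub>z\<partial>\<^sub>y - f\<^sub>y\<partial>\<^sub>z\<close> has determinant \<open>d f\<close> times a partial derivative of \<open>f\<close>.
\<close>

lemma dvd_curve_if_dvd_dets:
  assumes "reduced_curve f"
    and dets: "\<And>u v w. \<lbrakk>u \<in> D f; v \<in> D f; w \<in> D f\<rbrakk> \<Longrightarrow> h dvd det (coeff_matrix u v w)"
  shows "h dvd f"
proof -
  obtain d where d: "d \<ge> 1" "homogeneous d f"
    using assms(1) by (auto simp: reduced_curve_def)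
  define e :: Der where "e = vector [var_x, var_y, var_z]"
  define k1 :: Der where "k1 = vector [d_y f, - d_x f, 0]"
  define k2 :: Der where "k2 = vector [d_z f, 0, - d_x f]"
  define k3 :: Der where "k3 = vector [0, d_z f, - d_y f]"
  have "e \<in> D f" "k1 \<in> D f" "k2 \<in> D f" "k3 \<in> D f"
    using euler_identity[OF d(2)]
    by (simp_all add: D_def der_apply_def e_def k1_def k2_def k3_def)
  then have "h dvd det (coeff_matrix e k1 k2)" "h dvd det (coeff_matrix e k1 k3)"
      "h dvd det (coeff_matrix e k2 k3)"
    using dets by simp_all
  moreover have "det (coeff_matrix e k1 k2) = of_nat d * f * d_x f"
    "det (coeff_matrix e k1 k3) = of_nat d * f * d_y f"
    "det (coeff_matrix e k2 k3) = of_nat d * f * d_z f"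
    unfolding euler_identity[OF d(2), symmetric]
    by (simp_all add: det_coeff_matrix e_def k1_def k2_def k3_def algebra_simps)
  ultimately have "h dvd of_nat d * f"
    by (metis dvd_if_dvd_mult_coprime3[OF _ _ _ reduced_curve_gradient_coprime[OF assms(1)]])
  then show ?thesis
    using d(1) by (simp add: dvd_mult_unit_iff' is_unit_of_nat_S)
qed

text \<open>Putting the vanishing combination in place of \<open>u\<close>, \<open>v\<close> and
  \<open>w\<close> in turn isolates each coefficient times the determinant.\<close>

lemma det_nonzero_imp_coeffs_0:
  assumes "det (coeff_matrix u v w) \<noteq> 0" "a *s u + b *s v + c *s w = 0"
  shows "a = 0 \<and> b = 0 \<and> c = 0"
proof -
  have "a * det (coeff_matrix u v w) = det (coeff_matrix (a *s u + b *s v + c *s w) v w)"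
    "b * det (coeff_matrix u v w) = det (coeff_matrix u (a *s u + b *s v + c *s w) w)"
    "c * det (coeff_matrix u v w) = det (coeff_matrix u v (a *s u + b *s v + c *s w))"
    by (simp_all add: det_coeff_matrix_linear det_coeff_matrix_alternating)
  then show ?thesis unfolding assms(2) using assms(1) by (simp add: det_coeff_matrix_linear)
qed

lemma det_nonzero_imp_independent:
  assumes "det (coeff_matrix u v w) \<noteq> 0"
  shows "der.independent {u, v, w}"
proof -
  have "u \<noteq> v" "u \<noteq> w" "v \<noteq> w"
    using assms by (auto simp: det_coeff_matrix_alternating)
  then show ?thesis
    using det_nonzero_imp_coeffs_0[OF assms]
    by (simp add: der.dependent_finite add.assoc) blast
qed

text \<open>The determinant of the three generators divides all determinants over
  \<open>D f\<close>, hence \<open>f\<close>, so it is nonzero and they form a basis. The form with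
  \<open>T\<close> also covers smaller generating sets.\<close>

lemma free_curve_if_three_generators:
  assumes "reduced_curve f" "der.span T = D f" "T \<subseteq> {u, v, w}" "{u, v, w} \<subseteq> D f"
  shows "free_curve f"
proof -
  have span: "der.span {u, v, w} = D f"
    using der.span_mono[OF assms(3)] der.span_minimal[OF assms(4) subspace_D] assms(2) by blast
  have "det (coeff_matrix u v w) dvd det (coeff_matrix u' v' w')"
    if "u' \<in> {u, v, w}" "v' \<in> {u, v, w}" "w' \<in> {u, v, w}" for u' v' w'
    using that by (auto simp: det_coeff_matrix_alternating dvd_det_coeff_matrix_swap)
  from dvd_det_coeff_matrix_span[where T = "{u, v, w}", OF this] have "det (coeff_matrix u v w) dvd f"
    by (rule dvd_curve_if_dvd_dets[OF assms(1)]) (simp_all add: span)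
  then have "det (coeff_matrix u v w) \<noteq> 0"
    using assms(1) by (auto simp: reduced_curve_def)
  then show ?thesis
    using det_nonzero_imp_independent span unfolding free_curve_def by blast
qed

section \<open>Units as forms of degree zero\<close>

lemma is_unit_imp_homogeneous_0: "is_unit (p :: S) \<Longrightarrow> homogeneous 0 p"
  by (auto simp: is_unit_poly_iff homogeneous_def mcoeff_def coeff_pCons split: nat.splits)

lemma is_unit_if_homogeneous_0:
  assumes "homogeneous 0 p" "p \<noteq> 0"
  shows "is_unit p"
proof -
  have "p = [:[:[:mcoeff p 0 0 0:]:]:]"
  proof (rule mcoeff_eqI)
    fix i j k
    have "mcoeff [:[:[:c:]:]:] i j k = (if i + j + k = 0 then c else 0)" for c
      by (simp add: mcoeff_def coeff_pCons split: nat.splits)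
    with assms(1) show "mcoeff p i j k = mcoeff [:[:[:mcoeff p 0 0 0:]:]:] i j k"
      by (auto simp: homogeneous_def)
  qed
  moreover from this have "mcoeff p 0 0 0 \<noteq> 0" using assms(2) by auto
  ultimately show ?thesis
    by (metis dvd_field_iff is_unit_const_poly_iff)
qed

section \<open>Curves that are plus-one generated\<close>

lemma plus_one_generated_imp_linear_determinant:
  assumes "reduced_curve f" "plus_one_generated f"
  shows "\<exists>\<theta>1 \<theta>2 \<theta>3. {\<theta>1, \<theta>2, \<theta>3} \<subseteq> D f \<and>
       (\<forall>\<theta>\<in>{\<theta>1, \<theta>2, \<theta>3}. \<exists>e. homogeneous_der e \<theta>) \<and>
       (\<exists>g. det (coeff_matrix \<theta>1 \<theta>2 \<theta>3) = g * f \<and> g \<noteq> 0 \<and> homogeneous 1 g)"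
proof -
  obtain \<theta>1 \<theta>2 \<theta>3 \<theta>4 f1 f2 f3 f4 where
    hom: "\<forall>\<theta>\<in>{\<theta>1, \<theta>2, \<theta>3, \<theta>4}. \<exists>e. homogeneous_der e \<theta>"
    and "minimal_generators {\<theta>1, \<theta>2, \<theta>3, \<theta>4} f"
    and f4: "f4 \<noteq> 0" "homogeneous 1 f4"
    and rel: "\<And>a1 a2 a3 a4. a1 *s \<theta>1 + a2 *s \<theta>2 + a3 *s \<theta>3 + a4 *s \<theta>4 = 0 \<longleftrightarrow>
          (\<exists>h. a1 = h * f1 \<and> a2 = h * f2 \<and> a3 = h * f3 \<and> a4 = h * f4)"
    using assms(2) unfolding plus_one_generated_def by blast
  then have span: "der.span {\<theta>1, \<theta>2, \<theta>3, \<theta>4} = D f"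
    by (simp add: minimal_generators_def)
  then have in_D: "\<theta>1 \<in> D f" "\<theta>2 \<in> D f" "\<theta>3 \<in> D f" "\<theta>4 \<in> D f"
    using der.span_superset[of "{\<theta>1, \<theta>2, \<theta>3, \<theta>4}"] by auto
  have f0: "f \<noteq> 0" using assms(1) by (simp add: reduced_curve_def)
  \<comment> \<open>Signed maximal minors annihilate the rows of a 4 by 3 matrix: expand a 4 by 4
    determinant with a repeated column.\<close>
  have "det (coeff_matrix \<theta>2 \<theta>3 \<theta>4) *s \<theta>1 + (- det (coeff_matrix \<theta>1 \<theta>3 \<theta>4)) *s \<theta>2
      + det (coeff_matrix \<theta>1 \<theta>2 \<theta>4) *s \<theta>3 + (- det (coeff_matrix \<theta>1 \<theta>2 \<theta>3)) *s \<theta>4 = 0"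
    by (simp add: vec_eq_iff forall_3 det_coeff_matrix algebra_simps)
  then obtain h where "det (coeff_matrix \<theta>2 \<theta>3 \<theta>4) = h * f1" "- det (coeff_matrix \<theta>1 \<theta>3 \<theta>4) = h * f2"
    "det (coeff_matrix \<theta>1 \<theta>2 \<theta>4) = h * f3" "- det (coeff_matrix \<theta>1 \<theta>2 \<theta>3) = h * f4"
    unfolding rel by blast
  then have h: "det (coeff_matrix \<theta>2 \<theta>3 \<theta>4) = h * f1" "det (coeff_matrix \<theta>1 \<theta>3 \<theta>4) = h * (- f2)"
    "det (coeff_matrix \<theta>1 \<theta>2 \<theta>4) = h * f3" "det (coeff_matrix \<theta>1 \<theta>2 \<theta>3) = h * (- f4)"
    by (simp_all add: equation_minus_iff minus_equation_iff)
  then have h_dvd: "h dvd det (coeff_matrix \<theta>2 \<theta>3 \<theta>4)" "h dvd det (coeff_matrix \<theta>1 \<theta>3 \<theta>4)"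
    "h dvd det (coeff_matrix \<theta>1 \<theta>2 \<theta>4)" "h dvd det (coeff_matrix \<theta>1 \<theta>2 \<theta>3)"
    by simp_all
  have "h dvd det (coeff_matrix u v w)"
    if "u \<in> {\<theta>1, \<theta>2, \<theta>3, \<theta>4}" "v \<in> {\<theta>1, \<theta>2, \<theta>3, \<theta>4}" "w \<in> {\<theta>1, \<theta>2, \<theta>3, \<theta>4}" for u v w
    using that h_dvd
    by (elim insertE emptyE)
      (simp_all add: det_coeff_matrix_alternating dvd_det_coeff_matrix_swap)
  from dvd_det_coeff_matrix_span[where T = "{\<theta>1, \<theta>2, \<theta>3, \<theta>4}", OF this] have "h dvd f"
    by (rule dvd_curve_if_dvd_dets[OF assms(1)]) (simp_all add: span)
  then obtain k where k: "f = h * k" by (auto elim: dvdE)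
  with f0 have "h \<noteq> 0" "k \<noteq> 0" by auto
  have "f dvd h * f1" "f dvd h * (- f2)" "f dvd h * f3" "f dvd h * (- f4)"
    unfolding h[symmetric] using curve_dvd_det_coeff_matrix[OF assms(1)] in_D by simp_all
  then have "k dvd f1" "k dvd f2" "k dvd f3" "k dvd f4"
    using \<open>h \<noteq> 0\<close> by (simp_all add: k)
  then obtain f1' f2' f3' f4' where f': "f1 = k * f1'" "f2 = k * f2'" "f3 = k * f3'" "f4 = k * f4'"
    by (metis dvdE)
  \<comment> \<open>The multiplier 1 shows that the \<open>f\<close>'s themselves are a relation.
    Cancelling \<open>k\<close> leaves another one, which must be \<open>k'\<close> times the
    original; hence \<open>k'\<close> inverts \<open>k\<close>.\<close>
  have "k *s (f1' *s \<theta>1 + f2' *s \<theta>2 + f3' *s \<theta>3 + f4' *s \<theta>4) = k *s 0"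
    using rel[of f1 f2 f3 f4] exI[of "\<lambda>h. f1 = h * f1 \<and> f2 = h * f2 \<and> f3 = h * f3 \<and> f4 = h * f4" 1]
    by (simp add: f' der.scale_right_distrib)
  then have "f1' *s \<theta>1 + f2' *s \<theta>2 + f3' *s \<theta>3 + f4' *s \<theta>4 = 0"
    using \<open>k \<noteq> 0\<close> scale_Der_cancel by blast
  then obtain k' where "f4' = k' * f4" unfolding rel by blast
  then have "f4' * (k' * k) = f4' * 1" by (simp add: f' mult_ac)
  then have "k' * k = 1" using f4(1) f' by (metis mult_cancel_left mult_zero_right)
  then have "is_unit k'" by (metis dvd_triv_left)
  then have k': "is_unit (- k')" by simp
  have hk: "h = k' * f" using \<open>k' * k = 1\<close> by (simp add: k mult.left_commute)
  \<comment> \<open>The sign is that of the fourth minor, and \<open>k'\<close> is the unit by which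
    \<open>h\<close> differs from \<open>f\<close>.\<close>
  define g where "g = - k' * f4"
  have "det (coeff_matrix \<theta>1 \<theta>2 \<theta>3) = g * f"
    by (simp add: h g_def hk)
  moreover have "g \<noteq> 0" using f4 k' by (auto simp: g_def)
  moreover have "homogeneous 1 g"
    using homogeneous_mult[OF is_unit_imp_homogeneous_0[OF k'] f4(2)] by (simp add: g_def)
  moreover have "{\<theta>1, \<theta>2, \<theta>3} \<subseteq> D f" "\<forall>\<theta>\<in>{\<theta>1, \<theta>2, \<theta>3}. \<exists>e. homogeneous_der e \<theta>"
    using in_D hom by auto
  ultimately show ?thesis by blast
qed

section \<open>Constructing the fourth generator\<close>

locale linear_determinant =
  fixes f g :: S and \<theta>1 \<theta>2 \<theta>3 :: Der
  assumes reduced: "reduced_curve f"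
    and in_D: "{\<theta>1, \<theta>2, \<theta>3} \<subseteq> D f"
    and homogeneous_gens: "\<forall>\<theta>\<in>{\<theta>1, \<theta>2, \<theta>3}. \<exists>e. homogeneous_der e \<theta>"
    and det: "det (coeff_matrix \<theta>1 \<theta>2 \<theta>3) = g * f"
    and g: "homogeneous 1 g" "g \<noteq> 0"
begin

section \<open>Coordinates with respect to the three given derivations\<close>

abbreviation N :: "Der set" where "N \<equiv> der.span {\<theta>1, \<theta>2, \<theta>3}"

definition comb :: "S \<Rightarrow> S \<Rightarrow> S \<Rightarrow> Der" where
  "comb a b c = a *s \<theta>1 + b *s \<theta>2 + c *s \<theta>3"

lemma f_nonzero: "f \<noteq> 0"
  using reduced by (simp add: reduced_curve_def)

lemma det_nonzero: "det (coeff_matrix \<theta>1 \<theta>2 \<theta>3) \<noteq> 0"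
  using f_nonzero g(2) by (simp add: det)

lemma prime_g: "prime_elem g"
  using g by (rule linear_form_prime)

lemma comb_linear:
  "comb (a + a') (b + b') (c + c') = comb a b c + comb a' b' c'"
  "comb (a - a') (b - b') (c - c') = comb a b c - comb a' b' c'"
  "comb (r * a) (r * b) (r * c) = r *s comb a b c"
  by (simp_all add: comb_def vec_eq_iff algebra_simps)

lemma comb_eq_0_iff: "comb a b c = 0 \<longleftrightarrow> a = 0 \<and> b = 0 \<and> c = 0"
  using det_nonzero_imp_coeffs_0[OF det_nonzero] by (auto simp: comb_def)

lemma comb_eq_iff: "comb a b c = comb a' b' c' \<longleftrightarrow> a = a' \<and> b = b' \<and> c = c'"
  using comb_eq_0_iff[of "a - a'" "b - b'" "c - c'"] by (simp add: comb_linear)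

lemma N_iff: "\<eta> \<in> N \<longleftrightarrow> (\<exists>a b c. \<eta> = comb a b c)"
  by (simp add: der.span_breakdown_eq comb_def algebra_simps)

lemma comb_in_N: "comb a b c \<in> N"
  by (auto simp: N_iff)

lemma N_subset_D: "N \<subseteq> D f"
  using in_D subspace_D by (rule der.span_minimal)

lemma comb_in_D: "comb a b c \<in> D f"
  using comb_in_N N_subset_D by blast

text \<open>In Cramer's rule every determinant on the right is divisible by \<open>f\<close>, and
  the one on the left is \<open>g * f\<close>; cancel \<open>f\<close>.\<close>

lemma scaled_by_g_in_N:
  assumes "\<eta> \<in> D f"
  obtains a b c where "g *s \<eta> = comb a b c"
proof -
  have "f dvd det (coeff_matrix \<eta> \<theta>2 \<theta>3)" "f dvd det (coeff_matrix \<theta>1 \<eta> \<theta>3)"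
    "f dvd det (coeff_matrix \<theta>1 \<theta>2 \<eta>)"
    using in_D assms by (simp_all add: curve_dvd_det_coeff_matrix[OF reduced])
  then obtain a b c where abc: "det (coeff_matrix \<eta> \<theta>2 \<theta>3) = f * a"
    "det (coeff_matrix \<theta>1 \<eta> \<theta>3) = f * b" "det (coeff_matrix \<theta>1 \<theta>2 \<eta>) = f * c"
    by (metis dvdE)
  have "f *s (g *s \<eta>) = (g * f) *s \<eta>" by (simp add: mult.commute)
  also have "\<dots> = f *s comb a b c"
    unfolding det[symmetric] cramer_Der[of \<theta>1 \<theta>2 \<theta>3 \<eta>] abc
    by (simp add: comb_linear(3)[symmetric]) (simp add: comb_def)
  finally have "g *s \<eta> = comb a b c"
    by (rule scale_Der_cancel[OF f_nonzero])
  then show thesis using that by blast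
qed

text \<open>As \<open>g\<close> is prime, it divides the combination coordinatewise. For the
  quotient \<open>\<zeta>\<close>, both \<open>r *s \<zeta>\<close> and \<open>g *s \<zeta>\<close>
  lie in \<open>D f\<close>, and \<open>r\<close>, \<open>g\<close> are coprime.\<close>

lemma saturated:
  assumes "\<eta> \<in> D f" "\<not> g dvd r" "r *s comb a b c = g *s \<eta>"
  obtains \<zeta> where "\<zeta> \<in> D f" "comb a b c = g *s \<zeta>"
proof -
  have "g dvd comb a b c $ i" for i
  proof -
    have "r * comb a b c $ i = g * \<eta> $ i"
      using arg_cong[OF assms(3), of "\<lambda>v. v $ i"] by simp
    then have "g dvd r * comb a b c $ i" by simp
    with assms(2) show ?thesis
      using prime_g by (simp add: prime_elem_dvd_mult_iff)
  qed
  then have z: "comb a b c = g *s (\<chi> i. comb a b c $ i div g)" (is "_ = g *s ?\<zeta>")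
    by (simp add: vec_eq_iff)
  have "g *s (r *s ?\<zeta>) = g *s \<eta>"
    unfolding assms(3)[symmetric] by (subst z) (simp add: mult.commute)
  then have "r *s ?\<zeta> = \<eta>" by (rule scale_Der_cancel[OF g(2)])
  then have "f dvd der_apply ?\<zeta> f * r"
    using assms(1) der_apply_linear(2)[of r ?\<zeta> f] by (simp add: D_def mult.commute)
  moreover have "f dvd der_apply ?\<zeta> f * g"
    using comb_in_D[of a b c] der_apply_linear(2)[of g ?\<zeta> f]
    unfolding z[symmetric] by (simp add: D_def mult.commute)
  moreover have "coprime g r"
    using prime_g assms(2) by (rule prime_elem_imp_coprime)
  \<comment> \<open>The 0 pads the coprime pair to the triple that
    \<open>dvd_if_dvd_mult_coprime3\<close> expects.\<close>
  then have "is_unit (gcd g (gcd r 0))"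
    by simp
  ultimately have "f dvd der_apply ?\<zeta> f"
    by (metis dvd_if_dvd_mult_coprime3 dvd_0_right mult_zero_right)
  then have "?\<zeta> \<in> D f" by (simp add: D_def)
  with z show thesis using that by blast
qed

text \<open>
  The determinant of \<open>\<eta>\<close>, \<open>\<eta>'\<close> and one of the \<open>\<theta>\<^sub>i\<close> is a multiple of \<open>f\<close>; comparing it with
  \<open>det M(\<theta>\<^sub>1, \<theta>\<^sub>2, \<theta>\<^sub>3) = g f\<close> shows that the coordinates have rank at most one modulo \<open>g\<close>.
\<close>

lemma coordinates_proportional:
  assumes "\<eta> \<in> D f" "\<eta>' \<in> D f" "g *s \<eta> = comb a1 a2 a3" "g *s \<eta>' = comb b1 b2 b3"
  shows "g dvd a1 * b2 - a2 * b1" "g dvd a1 * b3 - a3 * b1" "g dvd a2 * b3 - a3 * b2"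
proof -
  have key: "g dvd m"
    if m: "det (coeff_matrix (comb a1 a2 a3) (comb b1 b2 b3) w) = m * (g * f)" and w: "w \<in> D f" for m w
  proof -
    obtain q where "det (coeff_matrix \<eta> \<eta>' w) = f * q"
      using curve_dvd_det_coeff_matrix[OF reduced assms(1,2) w] by (auto elim: dvdE)
    \<comment> \<open>Each of the first two arguments contributes a factor \<open>g\<close>; only
      one cancels.\<close>
    then have "m * (g * f) = g * q * (g * f)"
      unfolding m[symmetric] assms(3,4)[symmetric] det_coeff_matrix_linear by simp
    then have "m = g * q"
      using f_nonzero g(2) by (metis mult_cancel_right no_zero_divisors)
    then show ?thesis by simp
  qed
  have perm: "det (coeff_matrix \<theta>2 \<theta>1 \<theta>3) = - (g * f)" "det (coeff_matrix \<theta>1 \<theta>3 \<theta>2) = - (g * f)"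
    "det (coeff_matrix \<theta>3 \<theta>1 \<theta>2) = g * f" "det (coeff_matrix \<theta>2 \<theta>3 \<theta>1) = g * f"
    "det (coeff_matrix \<theta>3 \<theta>2 \<theta>1) = - (g * f)"
    unfolding det[symmetric] by (simp_all add: det_coeff_matrix algebra_simps)
  have "det (coeff_matrix (comb a1 a2 a3) (comb b1 b2 b3) \<theta>3) = (a1 * b2 - a2 * b1) * (g * f)"
    by (simp add: comb_def det_coeff_matrix_linear det_coeff_matrix_alternating det perm algebra_simps)
  from key[OF this] show "g dvd a1 * b2 - a2 * b1" using in_D by simp
  have "det (coeff_matrix (comb a1 a2 a3) (comb b1 b2 b3) \<theta>2) = (- (a1 * b3 - a3 * b1)) * (g * f)"
    by (simp add: comb_def det_coeff_matrix_linear det_coeff_matrix_alternating det perm algebra_simps)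
  from key[OF this] show "g dvd a1 * b3 - a3 * b1" using in_D by (simp only: dvd_minus_iff) simp
  have "det (coeff_matrix (comb a1 a2 a3) (comb b1 b2 b3) \<theta>1) = (a2 * b3 - a3 * b2) * (g * f)"
    by (simp add: comb_def det_coeff_matrix_linear det_coeff_matrix_alternating det perm algebra_simps)
  from key[OF this] show "g dvd a2 * b3 - a3 * b2" using in_D by simp
qed

text \<open>Coordinates of an element outside \<open>N\<close> are nonzero modulo \<open>g\<close>.
  Their primitive part \<open>v\<close> comes from some \<open>\<zeta>\<close> by saturation, and
  all other coordinates, being proportional to \<open>v\<close> modulo \<open>g\<close>, are
  multiples of it.\<close>

lemma cyclic_mod_N:
  assumes "D f \<noteq> N"
  obtains \<zeta> where "\<zeta> \<in> D f" "\<And>\<eta>. \<eta> \<in> D f \<Longrightarrow> \<exists>s. \<eta> - s *s \<zeta> \<in> N"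
proof -
  obtain \<theta> where \<theta>: "\<theta> \<in> D f" "\<theta> \<notin> N"
    using assms N_subset_D by blast
  obtain a1 a2 a3 where a: "g *s \<theta> = comb a1 a2 a3"
    using \<theta>(1) by (rule scaled_by_g_in_N)
  have not_dvd: "\<not> (g dvd a1 \<and> g dvd a2 \<and> g dvd a3)"
  proof
    assume "g dvd a1 \<and> g dvd a2 \<and> g dvd a3"
    then obtain c1 c2 c3 where "a1 = g * c1" "a2 = g * c2" "a3 = g * c3"
      by (metis dvdE)
    with a have "g *s \<theta> = g *s comb c1 c2 c3" by (simp add: comb_linear)
    then have "\<theta> = comb c1 c2 c3" by (rule scale_Der_cancel[OF g(2)])
    with \<theta>(2) show False by (simp add: comb_in_N)
  qed
  obtain r v1 v2 v3 where r: "g dvd a1 - r * v1" "g dvd a2 - r * v2" "g dvd a3 - r * v3"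
    and v: "\<And>w1 w2 w3. \<lbrakk>g dvd w1 * v2 - w2 * v1; g dvd w1 * v3 - w3 * v1; g dvd w2 * v3 - w3 * v2\<rbrakk>
      \<Longrightarrow> \<exists>s. g dvd w1 - s * v1 \<and> g dvd w2 - s * v2 \<and> g dvd w3 - s * v3"
    using primitive_triple_mod_linear_form[OF g not_dvd] by metis
  \<comment> \<open>Correcting by multiples of \<open>g\<close> replaces \<open>\<theta>\<close> by
    another representative of its class modulo \<open>N\<close>.\<close>
  obtain c1 c2 c3 where "a1 - r * v1 = g * c1" "a2 - r * v2 = g * c2" "a3 - r * v3 = g * c3"
    using r by (metis dvdE)
  then have c: "r * v1 = a1 - g * c1" "r * v2 = a2 - g * c2" "r * v3 = a3 - g * c3"
    by (simp_all add: algebra_simps)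
  have "r *s comb v1 v2 v3 = comb (r * v1) (r * v2) (r * v3)"
    by (simp add: comb_linear)
  also have "\<dots> = g *s (\<theta> - comb c1 c2 c3)"
    unfolding c comb_linear a[symmetric] by (simp add: vec_eq_iff algebra_simps)
  finally have rv: "r *s comb v1 v2 v3 = g *s (\<theta> - comb c1 c2 c3)" .
  have "\<not> g dvd r"
  proof
    assume "g dvd r"
    then have "g dvd a1" "g dvd a2" "g dvd a3"
      using dvd_add[OF r(1), of "r * v1"] dvd_add[OF r(2), of "r * v2"] dvd_add[OF r(3), of "r * v3"]
      by simp_all
    with not_dvd show False by simp
  qed
  moreover have "\<theta> - comb c1 c2 c3 \<in> D f"
    using \<theta>(1) comb_in_D subspace_D by (blast intro: der.subspace_diff)
  ultimately obtain \<zeta> where \<zeta>: "\<zeta> \<in> D f" "comb v1 v2 v3 = g *s \<zeta>"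
    using rv saturated by blast
  have "\<exists>s. \<eta> - s *s \<zeta> \<in> N" if "\<eta> \<in> D f" for \<eta>
  proof -
    obtain w1 w2 w3 where w: "g *s \<eta> = comb w1 w2 w3"
      using \<open>\<eta> \<in> D f\<close> by (rule scaled_by_g_in_N)
    obtain s where "g dvd w1 - s * v1" "g dvd w2 - s * v2" "g dvd w3 - s * v3"
      using v coordinates_proportional[OF \<open>\<eta> \<in> D f\<close> \<zeta>(1) w \<zeta>(2)[symmetric]] by metis
    then obtain d1 d2 d3 where d: "w1 - s * v1 = g * d1" "w2 - s * v2 = g * d2" "w3 - s * v3 = g * d3"
      by (metis dvdE)
    have "g *s (\<eta> - s *s \<zeta>) = comb (w1 - s * v1) (w2 - s * v2) (w3 - s * v3)"
      unfolding comb_linear \<zeta>(2) w[symmetric] by (simp add: vec_eq_iff algebra_simps)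
    also have "\<dots> = g *s comb d1 d2 d3"
      unfolding d comb_linear ..
    finally have "\<eta> - s *s \<zeta> = comb d1 d2 d3"
      by (rule scale_Der_cancel[OF g(2)])
    then show ?thesis by (metis comb_in_N)
  qed
  with \<zeta>(1) show thesis using that by blast
qed

text \<open>Comparing coordinates of \<open>s *s (g *s \<eta>)\<close> shows that \<open>g\<close>
  divides \<open>s\<close> times each coordinate of \<open>g *s \<eta>\<close>; now use that
  \<open>g\<close> is prime.\<close>

lemma torsion_free_mod_N:
  assumes "\<eta> \<in> D f" "s *s \<eta> \<in> N"
  shows "g dvd s \<or> \<eta> \<in> N"
proof (rule disjCI)
  assume "\<eta> \<notin> N"
  obtain a1 a2 a3 where a: "g *s \<eta> = comb a1 a2 a3"
    using assms(1) by (rule scaled_by_g_in_N)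
  obtain b1 b2 b3 where b: "s *s \<eta> = comb b1 b2 b3"
    using assms(2) unfolding N_iff by blast
  have "comb (s * a1) (s * a2) (s * a3) = s *s (g *s \<eta>)"
    by (simp add: comb_linear a)
  also have "\<dots> = g *s (s *s \<eta>)" by (simp add: mult.commute)
  also have "\<dots> = comb (g * b1) (g * b2) (g * b3)"
    by (simp add: comb_linear b)
  finally have *: "s * a1 = g * b1" "s * a2 = g * b2" "s * a3 = g * b3"
    by (simp_all add: comb_eq_iff)
  show "g dvd s"
  proof (rule ccontr)
    assume "\<not> g dvd s"
    moreover have "g dvd s * a1" "g dvd s * a2" "g dvd s * a3"
      by (simp_all add: *)
    ultimately have "g dvd a1" "g dvd a2" "g dvd a3"
      using prime_g by (simp_all add: prime_elem_dvd_mult_iff)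
    then obtain c1 c2 c3 where "a1 = g * c1" "a2 = g * c2" "a3 = g * c3"
      by (metis dvdE)
    with a have "g *s \<eta> = g *s comb c1 c2 c3" by (simp add: comb_linear)
    then have "\<eta> = comb c1 c2 c3" by (rule scale_Der_cancel[OF g(2)])
    with \<open>\<eta> \<notin> N\<close> show False by (simp add: comb_in_N)
  qed
qed

lemma g_multiple_in_N: "\<lbrakk>\<eta> \<in> D f; g dvd s\<rbrakk> \<Longrightarrow> s *s \<eta> \<in> N"
proof -
  assume "\<eta> \<in> D f" "g dvd s"
  then obtain q where "s = q * g" by (metis dvdE mult.commute)
  then have "s *s \<eta> = q *s (g *s \<eta>)" by simp
  moreover have "g *s \<eta> \<in> N"
    using \<open>\<eta> \<in> D f\<close> by (metis scaled_by_g_in_N comb_in_N)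
  ultimately show ?thesis by (metis der.span_scale)
qed

text \<open>\<open>N\<close> is graded because its generators are homogeneous.\<close>

lemma der_part_in_N:
  assumes "\<eta> \<in> N"
  shows "der_part n \<eta> \<in> N"
proof -
  obtain a b c where \<eta>: "\<eta> = comb a b c" using assms unfolding N_iff by blast
  have "der_part n (p *s \<theta>) \<in> N" if "\<theta> \<in> {\<theta>1, \<theta>2, \<theta>3}" for p \<theta>
  proof -
    obtain e where "homogeneous_der e \<theta>" using homogeneous_gens \<open>\<theta> \<in> {\<theta>1, \<theta>2, \<theta>3}\<close> by blast
    moreover have "\<theta> \<in> N" using that by (rule der.span_base)
    ultimately show ?thesis
      by (simp add: der_part_scale_homogeneous der.span_scale der.span_zero)
  qed
  then show ?thesis
    by (simp add: \<eta> comb_def der_part_add der.span_add)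
qed

text \<open>
  Modulo \<open>N\<close> the module is free of rank one over \<open>S/g\<close>, so its generator is homogeneous up to \<open>N\<close>:
  writing the top component of \<open>\<zeta>\<close> outside \<open>N\<close> as a multiple \<open>s \<zeta>\<close>, the product of the top
  components of \<open>s\<close> and \<open>\<zeta>\<close> does not vanish, which forces \<open>s\<close> to be constant modulo \<open>g\<close>.
\<close>

lemma homogeneous_generator_mod_N:
  assumes "D f \<noteq> N"
  obtains \<theta>4 m where "\<theta>4 \<in> D f" "homogeneous_der m \<theta>4"
    "\<And>\<eta>. \<eta> \<in> D f \<Longrightarrow> \<exists>s. \<eta> - s *s \<theta>4 \<in> N"
proof -
  obtain \<zeta> where \<zeta>: "\<zeta> \<in> D f" and gen: "\<And>\<eta>. \<eta> \<in> D f \<Longrightarrow> \<exists>s. \<eta> - s *s \<zeta> \<in> N"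
    using cyclic_mod_N[OF assms] by metis
  obtain d where "homogeneous d f"
    using reduced by (auto simp: reduced_curve_def)
  then have part_D: "der_part n \<zeta> \<in> D f" for n
    using \<zeta> by (rule der_part_in_D)
  have "\<zeta> \<notin> N"
  proof
    assume "\<zeta> \<in> N"
    have "\<eta> \<in> N" if "\<eta> \<in> D f" for \<eta>
    proof -
      obtain s where "\<eta> - s *s \<zeta> \<in> N" using gen \<open>\<eta> \<in> D f\<close> by blast
      then have "(\<eta> - s *s \<zeta>) + s *s \<zeta> \<in> N"
        using \<open>\<zeta> \<in> N\<close> by (intro der.span_add der.span_scale)
      then show ?thesis by simp
    qed
    with assms N_subset_D show False by blast
  qed
  obtain K where K: "\<zeta> = (\<Sum>n\<le>K. der_part n \<zeta>)" using sum_der_part[of \<zeta>] ..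
  \<comment> \<open>\<open>M\<close> is the degree of \<open>\<zeta>\<close> modulo
    \<open>N\<close>; the bound \<open>K\<close> guarantees that the maximum exists.\<close>
  define M where "M = (GREATEST n. n \<le> K \<and> der_part n \<zeta> \<notin> N)"
  have "\<exists>n\<le>K. der_part n \<zeta> \<notin> N"
    using \<open>\<zeta> \<notin> N\<close> K der.span_sum[of "{..K}" "\<lambda>n. der_part n \<zeta>" "{\<theta>1, \<theta>2, \<theta>3}"] by auto
  then have M: "M \<le> K \<and> der_part M \<zeta> \<notin> N"
    unfolding M_def using GreatestI_nat[where P = "\<lambda>n. n \<le> K \<and> der_part n \<zeta> \<notin> N" and b = K] by blast
  have above_M: "der_part n \<zeta> \<in> N" if "n > M" for n
  proof (cases "n \<le> K")
    case True
    then show ?thesis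
      using that Greatest_le_nat[where P = "\<lambda>n. n \<le> K \<and> der_part n \<zeta> \<notin> N" and b = K and k = n]
      unfolding M_def by force
  next
    case False
    have "der_part n \<zeta> = (\<Sum>m\<le>K. der_part n (der_part m \<zeta>))"
      by (subst K) (simp add: der_part_sum)
    also have "\<dots> = 0"
      using False by (intro sum.neutral) (auto simp: der_part_homogeneous[OF homogeneous_der_part])
    finally show ?thesis by (simp add: der.span_zero)
  qed
  obtain s where s: "der_part M \<zeta> - s *s \<zeta> \<in> N" using gen part_D by blast
  have "\<not> g dvd s"
  proof
    assume "g dvd s"
    then have "(der_part M \<zeta> - s *s \<zeta>) + s *s \<zeta> \<in> N"
      using s g_multiple_in_N[OF \<zeta>] by (intro der.span_add)
    with M show False by simp
  qed
  obtain L where "\<And>M. M \<ge> L \<Longrightarrow> s = (\<Sum>n\<le>M. hom_part n s)" using sum_hom_part[of s] by blast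
  then have L: "s = (\<Sum>n\<le>L. hom_part n s)" by blast
  \<comment> \<open>Likewise \<open>T\<close> is the degree of \<open>s\<close> modulo
    \<open>g\<close>.\<close>
  define T where "T = (GREATEST n. n \<le> L \<and> \<not> g dvd hom_part n s)"
  have "\<exists>n\<le>L. \<not> g dvd hom_part n s"
    using \<open>\<not> g dvd s\<close> L by (metis atMost_iff dvd_sum)
  then have T: "T \<le> L \<and> \<not> g dvd hom_part T s"
    unfolding T_def using GreatestI_nat[where P = "\<lambda>n. n \<le> L \<and> \<not> g dvd hom_part n s" and b = L] by blast
  have above_T: "g dvd hom_part n s" if "n > T" for n
  proof (cases "n \<le> L")
    case True
    then show ?thesis
      using that Greatest_le_nat[where P = "\<lambda>n. n \<le> L \<and> \<not> g dvd hom_part n s" and b = L and k = n]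
      unfolding T_def by force
  next
    case False
    have "hom_part n s = (\<Sum>m\<le>L. hom_part n (hom_part m s))"
      by (subst L) (simp add: hom_part_sum)
    also have "\<dots> = 0"
      using False by (intro sum.neutral) (auto simp: hom_part_homogeneous[OF homogeneous_hom_part])
    finally show ?thesis by simp
  qed
  have "T = 0"
  proof (rule ccontr)
    assume "T \<noteq> 0"
    \<comment> \<open>These are the terms of the component of \<open>s *s \<zeta>\<close> in degree
      \<open>T + M\<close>. Those with \<open>j > T\<close> lie in \<open>N\<close> through
      \<open>g\<close>, those with \<open>j < T\<close> by maximality of \<open>M\<close>. For
      \<open>T > 0\<close> the whole component lies in \<open>N\<close>, hence so does
      \<open>F T\<close>, against torsion-freeness.\<close>
    define F where "F j = hom_part j s *s der_part (T + M - j) \<zeta>" for j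
    have "F j \<in> N" if "j \<noteq> T" "j \<le> T + M" for j
    proof (cases "j > T")
      case True
      then show ?thesis unfolding F_def using g_multiple_in_N part_D above_T by blast
    next
      case False
      with that have "T + M - j > M" by simp
      then show ?thesis unfolding F_def by (intro der.span_scale above_M)
    qed
    then have "sum F ({..T + M} - {T}) \<in> N" by (intro der.span_sum) auto
    moreover have "der_part (T + M) (der_part M \<zeta> + (-1) *s (s *s \<zeta>)) \<in> N"
      using s by (intro der_part_in_N) simp
    then have "- der_part (T + M) (s *s \<zeta>) \<in> N"
      using \<open>T \<noteq> 0\<close> unfolding der_part_add
      by (simp add: der_part_homogeneous[OF homogeneous_der_part] der_part_uminus)
    from der.span_neg[OF this] have "sum F {..T + M} \<in> N"
      by (simp add: der_part_scale F_def)
    ultimately have "sum F {..T + M} - sum F ({..T + M} - {T}) \<in> N"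
      by (intro der.span_diff)
    then have "F T \<in> N" by (simp add: sum.remove[of "{..T + M}" T])
    then show False
      using torsion_free_mod_N[OF part_D] T M by (auto simp: F_def)
  qed
  define c where "c = hom_part 0 s"
  have "c \<noteq> 0" using T \<open>T = 0\<close> by (auto simp: c_def)
  then have "is_unit c"
    by (intro is_unit_if_homogeneous_0) (simp_all add: c_def)
  then obtain c' where c': "c' * c = 1" by (metis dvdE mult.commute)
  have "s - c = (\<Sum>n\<in>{..L} - {0}. hom_part n s)"
    unfolding c_def by (subst (1) L) (simp add: sum.remove[of "{..L}" 0])
  also have "g dvd \<dots>"
    using above_T \<open>T = 0\<close> by (intro dvd_sum) auto
  finally have "(s - c) *s \<zeta> \<in> N" by (rule g_multiple_in_N[OF \<zeta>])
  \<comment> \<open>Modulo \<open>N\<close>, the component \<open>der_part M \<zeta>\<close> is the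
    unit \<open>c\<close> times \<open>\<zeta>\<close>, so it generates as well.\<close>
  then have "c' *s ((der_part M \<zeta> - s *s \<zeta>) + (s - c) *s \<zeta>) \<in> N"
    by (rule der.span_scale[OF der.span_add[OF s]])
  also have "c' *s ((der_part M \<zeta> - s *s \<zeta>) + (s - c) *s \<zeta>) = c' *s der_part M \<zeta> - (c' * c) *s \<zeta>"
    by (simp add: vec_eq_iff algebra_simps)
  finally have \<zeta>': "c' *s der_part M \<zeta> - \<zeta> \<in> N" by (simp add: c')
  have "\<exists>t. \<eta> - t *s der_part M \<zeta> \<in> N" if "\<eta> \<in> D f" for \<eta>
  proof -
    obtain t where "\<eta> - t *s \<zeta> \<in> N" using gen \<open>\<eta> \<in> D f\<close> by blast
    then have "(\<eta> - t *s \<zeta>) - t *s (c' *s der_part M \<zeta> - \<zeta>) \<in> N"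
      by (rule der.span_diff[OF _ der.span_scale[OF \<zeta>']])
    also have "(\<eta> - t *s \<zeta>) - t *s (c' *s der_part M \<zeta> - \<zeta>) = \<eta> - (t * c') *s der_part M \<zeta>"
      by (simp add: vec_eq_iff algebra_simps)
    finally show ?thesis by blast
  qed
  with part_D show thesis using that homogeneous_der_part by blast
qed

text \<open>Take the component of degree \<open>1 + m\<close> on both sides: the left side is
  unchanged, while the coefficients are replaced by homogeneous ones.\<close>

lemma scaled_by_g_homogeneous:
  assumes "\<eta> \<in> D f" "homogeneous_der m \<eta>"
  obtains a b c where "g *s \<eta> = comb a b c" "\<exists>e. homogeneous e a" "\<exists>e. homogeneous e b" "\<exists>e. homogeneous e c"
proof -
  obtain a b c where abc: "g *s \<eta> = comb a b c"
    using assms(1) by (rule scaled_by_g_in_N)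
  have "homogeneous_der (1 + m) (g *s \<eta>)"
    using assms(2) g(1) by (simp add: homogeneous_der_def homogeneous_mult del: One_nat_def)
  then have "g *s \<eta> = der_part (1 + m) (comb a b c)"
    by (simp add: der_part_homogeneous flip: abc)
  moreover have "\<exists>p'. der_part n (p *s \<theta>) = p' *s \<theta> \<and> (\<exists>e. homogeneous e p')"
    if "\<theta> \<in> {\<theta>1, \<theta>2, \<theta>3}" for n p \<theta>
  proof -
    obtain e where "homogeneous_der e \<theta>" using homogeneous_gens \<open>\<theta> \<in> {\<theta>1, \<theta>2, \<theta>3}\<close> by blast
    \<comment> \<open>If \<open>e\<close> exceeds \<open>n\<close>, the coefficient is 0, which is
      homogeneous of every degree.\<close>
    then have "der_part n (p *s \<theta>) = (if e \<le> n then hom_part (n - e) p else 0) *s \<theta>"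
      by (simp add: der_part_scale_homogeneous)
    then show ?thesis by (metis homogeneous_0 homogeneous_hom_part)
  qed
  then obtain a' b' c' where "der_part (1 + m) (a *s \<theta>1) = a' *s \<theta>1" "\<exists>e. homogeneous e a'"
    "der_part (1 + m) (b *s \<theta>2) = b' *s \<theta>2" "\<exists>e. homogeneous e b'"
    "der_part (1 + m) (c *s \<theta>3) = c' *s \<theta>3" "\<exists>e. homogeneous e c'"
    by (metis insertCI)
  ultimately show thesis
    using that[of a' b' c'] by (simp add: comb_def der_part_add)
qed

text \<open>Writing \<open>g *s \<theta>4\<close> in the first three generators gives the relation,
  with \<open>- g\<close> as fourth coefficient. Distinctness and minimality hold because three
  generators would make the curve free.\<close>

lemma not_free_imp_plus_one_generated:
  assumes "\<not> free_curve f"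
  shows "plus_one_generated f"
proof -
  have not_free: False
    if "der.span T = D f" "T \<subseteq> {u, v, w}" "{u, v, w} \<subseteq> D f" for T u v w
    using free_curve_if_three_generators[OF reduced that] assms by simp
  have "D f \<noteq> N"
    using not_free[of "{\<theta>1, \<theta>2, \<theta>3}" \<theta>1 \<theta>2 \<theta>3] in_D by auto
  then obtain \<theta>4 m where \<theta>4: "\<theta>4 \<in> D f" "homogeneous_der m \<theta>4"
    and gen: "\<And>\<eta>. \<eta> \<in> D f \<Longrightarrow> \<exists>s. \<eta> - s *s \<theta>4 \<in> N"
    using homogeneous_generator_mod_N by metis
  obtain f1 f2 f3 where rel: "g *s \<theta>4 = comb f1 f2 f3"
    and hom: "\<exists>e. homogeneous e f1" "\<exists>e. homogeneous e f2" "\<exists>e. homogeneous e f3"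
    using scaled_by_g_homogeneous[OF \<theta>4] by metis
  let ?T = "{\<theta>1, \<theta>2, \<theta>3, \<theta>4}"
  have T_D: "?T \<subseteq> D f" using in_D \<theta>4(1) by simp
  have "?T = insert \<theta>4 {\<theta>1, \<theta>2, \<theta>3}" by auto
  then have "D f \<subseteq> der.span ?T"
    using gen by (auto simp: der.span_breakdown_eq[of _ \<theta>4])
  then have span: "der.span ?T = D f"
    using der.span_minimal[OF T_D subspace_D] by blast
  have "distinct [\<theta>1, \<theta>2, \<theta>3, \<theta>4]"
  proof (rule ccontr)
    assume "\<not> distinct [\<theta>1, \<theta>2, \<theta>3, \<theta>4]"
    then have "?T \<subseteq> {\<theta>1, \<theta>2, \<theta>3} \<or> ?T \<subseteq> {\<theta>1, \<theta>2, \<theta>4} \<or> ?T \<subseteq> {\<theta>1, \<theta>3, \<theta>4} \<or> ?T \<subseteq> {\<theta>2, \<theta>3, \<theta>4}"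
      by auto
    with not_free[OF span] T_D show False by auto
  qed
  moreover have "\<forall>\<theta>\<in>?T. \<exists>e. homogeneous_der e \<theta>"
    using homogeneous_gens \<theta>4(2) by auto
  moreover have "minimal_generators ?T f"
    unfolding minimal_generators_def
  proof (intro conjI allI impI notI)
    show "der.span ?T = D f" by (rule span)
    fix T'
    assume "T' \<subset> ?T" and span': "der.span T' = D f"
    then have "T' \<subseteq> {\<theta>1, \<theta>2, \<theta>3} \<or> T' \<subseteq> {\<theta>1, \<theta>2, \<theta>4} \<or> T' \<subseteq> {\<theta>1, \<theta>3, \<theta>4} \<or> T' \<subseteq> {\<theta>2, \<theta>3, \<theta>4}"
      by blast
    with not_free[OF span'] T_D show False by auto
  qed
  moreover have "\<forall>p\<in>{f1, f2, f3, - g}. \<exists>e. homogeneous e p" "- g \<noteq> 0" "homogeneous 1 (- g)"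
    using hom g by (auto simp: homogeneous_def mcoeff_def)
  moreover have "a1 *s \<theta>1 + a2 *s \<theta>2 + a3 *s \<theta>3 + a4 *s \<theta>4 = 0 \<longleftrightarrow>
      (\<exists>h. a1 = h * f1 \<and> a2 = h * f2 \<and> a3 = h * f3 \<and> a4 = h * (- g))" for a1 a2 a3 a4
  proof
    assume "\<exists>h. a1 = h * f1 \<and> a2 = h * f2 \<and> a3 = h * f3 \<and> a4 = h * (- g)"
    then obtain h where "a1 = h * f1" "a2 = h * f2" "a3 = h * f3" "a4 = h * (- g)" by blast
    then have "a1 *s \<theta>1 + a2 *s \<theta>2 + a3 *s \<theta>3 + a4 *s \<theta>4 = h *s (comb f1 f2 f3 - g *s \<theta>4)"
      by (simp add: comb_def vec_eq_iff algebra_simps)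
    then show "a1 *s \<theta>1 + a2 *s \<theta>2 + a3 *s \<theta>3 + a4 *s \<theta>4 = 0" by (simp add: rel)
  next
    assume "a1 *s \<theta>1 + a2 *s \<theta>2 + a3 *s \<theta>3 + a4 *s \<theta>4 = 0"
    then have eq: "comb a1 a2 a3 + a4 *s \<theta>4 = 0" by (simp add: comb_def)
    then have "a4 *s \<theta>4 = comb (- a1) (- a2) (- a3)"
      by (simp add: comb_def vec_eq_iff eq_neg_iff_add_eq_0 algebra_simps)
    then have "a4 *s \<theta>4 \<in> N" by (simp add: comb_in_N)
    moreover have "\<theta>4 \<notin> N"
    proof
      assume "\<theta>4 \<in> N"
      then have "?T \<subseteq> N"
        using der.span_superset[of "{\<theta>1, \<theta>2, \<theta>3}"] by auto
      then have "D f \<subseteq> N"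
        unfolding span[symmetric] by (rule der.span_minimal) (rule der.subspace_span)
      with \<open>D f \<noteq> N\<close> N_subset_D show False by blast
    qed
    \<comment> \<open>Torsion-freeness turns \<open>a4 *s \<theta>4 \<in> N\<close> into
      divisibility of \<open>a4\<close> by \<open>g\<close>. Substituting for
      \<open>g *s \<theta>4\<close> leaves a relation of the independent \<open>\<theta>1\<close>,
      \<open>\<theta>2\<close>, \<open>\<theta>3\<close>, so the multiplier is
      \<open>- c\<close>.\<close>
    ultimately obtain c where c: "a4 = c * g"
      using torsion_free_mod_N[OF \<theta>4(1)] by (metis dvdE mult.commute)
    have "comb (a1 + c * f1) (a2 + c * f2) (a3 + c * f3) = comb a1 a2 a3 + c *s (g *s \<theta>4)"
      unfolding comb_linear rel ..
    also have "\<dots> = 0" using eq by (simp add: c)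
    finally have "a1 = (- c) * f1 \<and> a2 = (- c) * f2 \<and> a3 = (- c) * f3 \<and> a4 = (- c) * (- g)"
      by (simp add: comb_eq_0_iff c eq_neg_iff_add_eq_0)
    then show "\<exists>h. a1 = h * f1 \<and> a2 = h * f2 \<and> a3 = h * f3 \<and> a4 = h * (- g)" by blast
  qed
  ultimately show ?thesis
    unfolding plus_one_generated_def by blast
qed

end

theorem theorem3p2:
  fixes f :: S
  assumes "reduced_curve f" and "\<not> free_curve f"
  shows "plus_one_generated f \<longleftrightarrow>
    (\<exists>\<theta>1 \<theta>2 \<theta>3. {\<theta>1, \<theta>2, \<theta>3} \<subseteq> D f \<and>
       (\<forall>\<theta>\<in>{\<theta>1, \<theta>2, \<theta>3}. \<exists>e. homogeneous_der e \<theta>) \<and>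
       (\<exists>g123. det (coeff_matrix \<theta>1 \<theta>2 \<theta>3) = g123 * f \<and> g123 \<noteq> 0 \<and> g123 \<in> graded_part 1))"
  (is "_ \<longleftrightarrow> ?R")
proof
  assume "plus_one_generated f"
  from plus_one_generated_imp_linear_determinant[OF assms(1) this] show ?R
    by (simp add: graded_part_def)
next
  assume ?R
  then obtain \<theta>1 \<theta>2 \<theta>3 g where "linear_determinant f g \<theta>1 \<theta>2 \<theta>3"
    unfolding linear_determinant_def graded_part_def using assms(1) by blast
  then show "plus_one_generated f"
    using assms(2) by (rule linear_determinant.not_free_imp_plus_one_generated)
qed

end
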